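(* Let $\Omega\subseteq\mathbb R^n$, $n\ge1$, be open and bounded, and let $\nu$ be a positive Borel measure on $\Omega$ such that there exist $\lambda\in(0,n]$, $r_0>0$, $C'>0$ with $\nu(B(x,r)\cap\Omega)\le C'r^\lambda$ for all $x\in\mathbb R^n$, $r\in(0,r_0]$. Let $0<d<n$, $p=n/d$, $\frac1p+\frac1{p'}=1$. For $f\in L^p(\Omega)$ real-valued and $F\in L^p(\Omega;\mathbb R^n)$ define $$Tf(x)=\int_\Omega|x-y|^{d-n}f(y)\,dy,\qquad T_1F(x)=\int_\Omega|x-y|^{d-n-1}(x-y)\cdot F(y)\,dy.$$ Then there exists $C$ such that $$\int_\Omega\exp\bigg[\frac{\lambda}{\omega_{n-1}}\bigg(\frac{|Tf(x)|}{\|f\|_p}\bigg)^{p'}\bigg]d\nu(x)\le C\quad\text{for all }f\in L^p(\Omega),$$ $$\int_\Omega\exp\bigg[\frac{\lambda}{\omega_{n-1}}\bigg(\frac{|T_1F(x)|}{\|F\|_p}\bigg)^{p'}\bigg]d\nu(x)\le C\quad\text{for all }F\in L^p(\Omega).$$ The constant $\lambda/\omega_{n-1}$ is sharp in both inequalities (cannot be replaced by a larger constant), provided there exist $x_0\in\Omega$ and $r_1,C_1>0$ with $\nu(B(x_0,r)\cap\Omega)\ge C_1r^\lambda$ for $0<r\le r_1$.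
   Context: $B(x,r)$ is the open Euclidean ball; $\omega_{n-1}$ is the surface measure of the unit sphere in $\mathbb R^n$; $L^p(\Omega)$ and $\|\cdot\|_p$ refer to Lebesgue measure on $\Omega$, with $|F|$ the Euclidean norm for vector-valued $F$. *)

theory Defs
  imports "HOL-Analysis.Analysis"
begin

text \<open>Surface measure of the unit sphere S^(n-1) in R^n: 2 pi^(n/2) / Gamma(n/2).\<close>
definition sphere_area :: "nat \<Rightarrow> real" where
  "sphere_area n = 2 * pi powr (real n / 2) / Gamma (real n / 2)"

definition Lp_on :: "'a::euclidean_space set \<Rightarrow> real \<Rightarrow> ('a \<Rightarrow> 'b::euclidean_space) set" where
  "Lp_on \<Omega> p = {f. set_borel_measurable lebesgue \<Omega> f \<and>
      (\<integral>\<^sup>+ y\<in>\<Omega>. ennreal (norm (f y) powr p) \<partial>lebesgue) < \<infinity>}"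

definition Lp_norm_on :: "'a::euclidean_space set \<Rightarrow> real \<Rightarrow> ('a \<Rightarrow> 'b::euclidean_space) \<Rightarrow> real" where
  "Lp_norm_on \<Omega> p f = enn2real (\<integral>\<^sup>+ y\<in>\<Omega>. ennreal (norm (f y) powr p) \<partial>lebesgue) powr (1 / p)"

definition T_kernel :: "real \<Rightarrow> ('a::euclidean_space \<Rightarrow> real) \<Rightarrow> 'a \<Rightarrow> 'a \<Rightarrow> real" where
  "T_kernel d f x y = norm (x - y) powr (d - real DIM('a)) * f y"

definition T1_kernel :: "real \<Rightarrow> ('a::euclidean_space \<Rightarrow> 'a) \<Rightarrow> 'a \<Rightarrow> 'a \<Rightarrow> real" where
  "T1_kernel d F x y = norm (x - y) powr (d - real DIM('a) - 1) * ((x - y) \<bullet> F y)"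

text \<open>Exponential functional
  \<integral>_\<Omega> exp[\<beta> (|\<integral>_\<Omega> k x y dy| / N)^q] d\<nu>(x);
  at points x where the defining integral of the potential does not converge
  (absolutely), the integrand is taken to be +\<infinity>.\<close>
definition exp_functional ::
  "'a::euclidean_space measure \<Rightarrow> 'a set \<Rightarrow> real \<Rightarrow> real \<Rightarrow> ('a \<Rightarrow> 'a \<Rightarrow> real) \<Rightarrow> real \<Rightarrow> ennreal" where
  "exp_functional \<nu> \<Omega> \<beta> q k N =
     (\<integral>\<^sup>+ x\<in>\<Omega>. (if set_integrable lebesgue \<Omega> (k x)
                 then ennreal (exp (\<beta> * (\<bar>LINT y:\<Omega>|lebesgue. k x y\<bar> / N) powr q))
                 else \<infinity>) \<partial>\<nu>)"

end

theory Submission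
  imports Defs
begin

text \<open>
  Upper bound, without rearrangements, with \<open>q = p'\<close>: normalise \<open>\<parallel>f\<parallel>\<^sub>p = 1\<close> and let \<open>U\<close> be the potential of \<open>\<bar>f\<bar>\<close>. If
  \<open>U \<ge> s\<close> on \<open>E\<close> and \<open>\<nu>(E) = \<delta>\<^sup>\<lambda>\<close>, average \<open>U\<close> over \<open>E\<close> and pass to the dual
  side: \<open>s \<le> \<integral> f K\<close>, where \<open>K\<close> is the average over \<open>E\<close> of the kernel. By Jensen, the part of \<open>K\<close>
  from distances at least \<open>\<delta>\<close> has \<open>q\<close>-th power integral at most \<open>\<omega> ln (R / \<delta>)\<close>, and the rest has
  bounded \<open>L\<^sup>q\<close> norm by the growth condition; as the outer part is at most \<open>\<delta> powr (d - n)\<close>, the cross terms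
  are bounded too. Hence \<open>s powr q \<le> (\<omega> / \<lambda>) (ln (1 / \<nu>(E)) + const)\<close>. This loses a
  logarithmic factor when summed over levels, which is recovered as in Adams' lemma: if \<open>f\<close> nearly
  saturates this bound on \<open>E1\<close>, then it pairs only weakly with the inner part of the averaged kernel of a
  smaller level set \<open>E2\<close>, so that \<open>E1\<close> and \<open>E2\<close> can both be nearly saturated only if
  their levels are close. The number of levels saturated up to a factor \<open>exp (- k)\<close> therefore
  grows polynomially in \<open>k\<close>.

  Sharpness: test with \<open>norm (x0 - y) powr (- d)\<close> on the annulus \<open>\<epsilon> \<le> norm (x0 - y) \<le> r\<close> and let \<open>\<epsilon>\<close> tend to 0.
\<close>

subsection \<open>Integral inequalities and radial integrals\<close>

text \<open>Young's inequality for the two normalised functions, integrated. Positive upper bounds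
  \<open>A\<close> and \<open>B\<close> replace the integrals themselves, so vanishing or infinite
  norms need no separate treatment.\<close>

lemma nn_integral_Holder:
  fixes f g :: "'b \<Rightarrow> real"
  assumes [measurable]: "f \<in> borel_measurable M" "g \<in> borel_measurable M"
    and nn: "\<And>x. 0 \<le> f x" "\<And>x. 0 \<le> g x"
    and pq: "p > 1" "q > 1" "1 / p + 1 / q = 1"
    and A: "(\<integral>\<^sup>+ x. ennreal (f x powr p) \<partial>M) \<le> ennreal A" "A > 0"
    and B: "(\<integral>\<^sup>+ x. ennreal (g x powr q) \<partial>M) \<le> ennreal B" "B > 0"
  shows "(\<integral>\<^sup>+ x. ennreal (f x * g x) \<partial>M) \<le> ennreal (A powr (1 / p) * B powr (1 / q))"
proof -
  define K where "K = A powr (1 / p) * B powr (1 / q)"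
  have "f x * g x \<le> K / (A * p) * f x powr p + K / (B * q) * g x powr q" for x
  proof -
    have "f x / A powr (1 / p) * (g x / B powr (1 / q))
      \<le> (f x / A powr (1 / p)) powr p / p + (g x / B powr (1 / q)) powr q / q"
      using pq nn by (intro Youngs_inequality) auto
    also have "\<dots> = f x powr p / (A * p) + g x powr q / (B * q)"
      using pq A B nn by (simp add: powr_divide powr_powr)
    finally have "K * (f x / A powr (1 / p) * (g x / B powr (1 / q)))
        \<le> K * (f x powr p / (A * p) + g x powr q / (B * q))"
      using A B by (intro mult_left_mono) (auto simp: K_def)
    then show ?thesis using A B by (simp add: K_def field_simps)
  qed
  then have "(\<integral>\<^sup>+ x. ennreal (f x * g x) \<partial>M) \<le>
     (\<integral>\<^sup>+ x. ennreal (K / (A * p)) * ennreal (f x powr p) + ennreal (K / (B * q)) * ennreal (g x powr q) \<partial>M)"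
    using A B pq
    by (intro nn_integral_mono)
       (simp add: K_def flip: ennreal_mult' ennreal_plus)
  also have "\<dots> = ennreal (K / (A * p)) * (\<integral>\<^sup>+ x. ennreal (f x powr p) \<partial>M)
      + ennreal (K / (B * q)) * (\<integral>\<^sup>+ x. ennreal (g x powr q) \<partial>M)"
    by (subst nn_integral_add) (auto simp: nn_integral_cmult)
  also have "\<dots> \<le> ennreal (K / (A * p)) * ennreal A + ennreal (K / (B * q)) * ennreal B"
    using A B by (intro add_mono mult_left_mono) auto
  also have "\<dots> = ennreal (K / p + K / q)"
    using A B pq by (simp add: K_def flip: ennreal_mult' ennreal_plus)
  also have "K / p + K / q = K"
    using pq by (metis distrib_left mult.right_neutral times_divide_eq_right)
  finally show ?thesis unfolding K_def .
qed

text \<open>With \<open>g = 1\<close> on a probability space this is Jensen's inequality; with a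
  genuine second factor it serves in \<open>H_inner\<close>. The use of \<open>enn2real\<close>
  matches the later definition of \<open>kavg\<close>.\<close>

lemma nn_integral_Holder_powr:
  fixes f g :: "'b \<Rightarrow> real"
  assumes [measurable]: "f \<in> borel_measurable M" "g \<in> borel_measurable M"
    and nn: "\<And>x. 0 \<le> f x" "\<And>x. 0 \<le> g x"
    and pq: "p > 1" "q > 1" "1 / p + 1 / q = 1"
    and B: "(\<integral>\<^sup>+ x. ennreal (g x powr p) \<partial>M) \<le> ennreal B" "B > 0"
  shows "ennreal (enn2real (\<integral>\<^sup>+ x. ennreal (f x * g x) \<partial>M) powr q)
    \<le> ennreal (B powr (q / p)) * (\<integral>\<^sup>+ x. ennreal (f x powr q) \<partial>M)"
proof (cases "(\<integral>\<^sup>+ x. ennreal (f x powr q) \<partial>M) = \<infinity>")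
  case True
  then show ?thesis using B by (simp add: ennreal_mult_top)
next
  case False
  then obtain A where A: "(\<integral>\<^sup>+ x. ennreal (f x powr q) \<partial>M) = ennreal A" "A \<ge> 0"
    by (cases "\<integral>\<^sup>+ x. ennreal (f x powr q) \<partial>M") auto
  define I where "I = enn2real (\<integral>\<^sup>+ x. ennreal (f x * g x) \<partial>M)"
  \<comment> \<open>The slack \<open>e\<close> keeps \<open>A + e\<close> positive, as
    \<open>nn_integral_Holder\<close> demands, even if \<open>A = 0\<close>; it is let tend to 0
    afterwards.\<close>
  have bd: "I powr q \<le> B powr (q / p) * A + B powr (q / p) * e" if "e > 0" for e
  proof -
    have "(\<integral>\<^sup>+ x. ennreal (f x * g x) \<partial>M) \<le> ennreal ((A + e) powr (1 / q) * B powr (1 / p))"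
      using that A B pq nn by (intro nn_integral_Holder) (auto simp: add.commute)
    then have "I \<le> (A + e) powr (1 / q) * B powr (1 / p)"
      unfolding I_def by (metis enn2real_leI mult_nonneg_nonneg powr_ge_zero)
    then have "I powr q \<le> ((A + e) powr (1 / q) * B powr (1 / p)) powr q"
      using pq by (intro powr_mono2) (auto simp: I_def)
    also have "\<dots> = (A + e) * B powr (q / p)"
      using A B pq that by (simp add: powr_mult powr_powr)
    finally show ?thesis by (simp add: algebra_simps)
  qed
  have "I powr q \<le> B powr (q / p) * A"
  proof (rule field_le_epsilon)
    fix e :: real assume "e > 0"
    then show "I powr q \<le> B powr (q / p) * A + e"
      using bd[of "e / B powr (q / p)"] B by simp
  qed
  then show ?thesis unfolding A I_def[symmetric]
    using A by (simp flip: ennreal_mult')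
qed

lemma nn_integral_lborel_reflect:
  fixes x :: "'a::euclidean_space"
  assumes [measurable]: "g \<in> borel_measurable borel"
  shows "(\<integral>\<^sup>+ y. g (x - y) \<partial>lborel) = (\<integral>\<^sup>+ z. g z \<partial>lborel)"
proof -
  have "lborel = density (distr lborel borel (\<lambda>y. x + (-1) *\<^sub>R y)) (\<lambda>_. ennreal (\<bar>-1\<bar> ^ DIM('a)))"
    using lborel_affine[of "-1" x] by simp
  then have "(\<integral>\<^sup>+ z. g z \<partial>lborel) = (\<integral>\<^sup>+ z. g z \<partial>density (distr lborel borel (\<lambda>y. x + (-1) *\<^sub>R y)) (\<lambda>_. ennreal (\<bar>-1\<bar> ^ DIM('a))))"
    by (rule arg_cong)
  also have "\<dots> = (\<integral>\<^sup>+ y. g (x + (-1) *\<^sub>R y) \<partial>lborel)"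
    by (subst nn_integral_density) (simp_all add: nn_integral_distr)
  finally show ?thesis by simp
qed

lemma sphere_area_eq: "n > 0 \<Longrightarrow> sphere_area n = real n * unit_ball_vol (real n)"
proof -
  assume n: "n > 0"
  then have "real n / 2 \<notin> \<int>\<^sub>\<le>\<^sub>0"
    by (auto elim!: nonpos_Ints_cases)
  then have "Gamma (real n / 2 + 1) = real n / 2 * Gamma (real n / 2)"
    by (rule Gamma_plus1)
  then have "unit_ball_vol (real n) = pi powr (real n / 2) / (real n / 2 * Gamma (real n / 2))"
    by (simp only: unit_ball_vol_def)
  moreover have "Gamma (real n / 2) > 0"
    using n by (intro Gamma_real_pos) auto
  ultimately show ?thesis
    unfolding sphere_area_def using n by simp
qed

lemma sphere_area_pos: "n > 0 \<Longrightarrow> sphere_area n > 0"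
  by (simp add: sphere_area_eq)

text \<open>Polar coordinates for radial integrands. For \<open>a \<ge> 0\<close> both measures give
  \<open>{..a}\<close> the volume of the ball of radius \<open>a\<close>, and these half-lines are
  an intersection-stable generator of the Borel sets.\<close>

lemma distr_norm_lborel:
  "distr lborel borel (norm :: 'a::euclidean_space \<Rightarrow> real)
     = density lborel (\<lambda>r. ennreal (sphere_area DIM('a) * r ^ (DIM('a) - 1) * indicator {0..} r))"
    (is "?L = ?R")
proof (rule measure_eqI_generator_eq[where E="range atMost" and \<Omega>=UNIV and A="\<lambda>i. {.. real i}"])
  let ?n = "DIM('a)"
  have L: "emeasure ?L {..a} = ennreal (unit_ball_vol ?n * a ^ ?n)" if "a \<ge> 0" for a
  proof -
    have "emeasure ?L {..a} = emeasure lborel (cball (0::'a) a)"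
      by (subst emeasure_distr) (auto simp: vimage_def cball_def intro!: arg_cong[where f="emeasure _"])
    then show ?thesis using that by (simp add: emeasure_cball)
  qed
  have R: "emeasure ?R {..a} = ennreal (unit_ball_vol ?n * a ^ ?n)" if "a \<ge> 0" for a
  proof -
    have "emeasure ?R {..a} = (\<integral>\<^sup>+ r. ennreal (sphere_area ?n * r ^ (?n - 1)) * indicator {0..a} r \<partial>lborel)"
      by (subst emeasure_density) (auto intro!: nn_integral_cong simp: indicator_def)
    also have "\<dots> = unit_ball_vol ?n * a ^ ?n - unit_ball_vol ?n * 0 ^ ?n"
      using that
      by (intro nn_integral_FTC_Icc)
         (auto intro!: derivative_eq_intros mult_nonneg_nonneg less_imp_le[OF sphere_area_pos] simp: sphere_area_eq)
    finally show ?thesis by (simp add: power_0_left)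
  qed
  have neg: "emeasure ?L {..a} = 0" "emeasure ?R {..a} = 0" if "a < 0" for a
  proof -
    have "{x. norm (x::'a) \<le> a} = {}" using that by (auto simp: not_le intro: less_le_trans)
    then show "emeasure ?L {..a} = 0"
      by (subst emeasure_distr) (auto simp: vimage_def)
    show "emeasure ?R {..a} = 0" using that
      by (subst emeasure_density) (auto simp: indicator_def nn_integral_0_iff_AE intro!: AE_I2)
  qed
  show "emeasure ?L X = emeasure ?R X" if "X \<in> range atMost" for X
  proof -
    from that obtain a where X: "X = {..a}" by auto
    show ?thesis unfolding X using L[of a] R[of a] neg[of a] by (cases "a \<ge> 0") auto
  qed
  show "Int_stable (range atMost :: real set set)" by (auto simp: Int_stable_def)
  show "sets ?L = sigma_sets UNIV (range atMost)" "sets ?R = sigma_sets UNIV (range atMost)"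
    by (simp_all add: borel_eq_atMost[THEN arg_cong[where f=sets]])
  show "range (\<lambda>i. {..real i}) \<subseteq> range atMost" by auto
  show "(\<Union>i. {..real i}) = UNIV" using real_arch_simple by blast
  show "emeasure ?L {..real i} \<noteq> \<infinity>" for i using L[of "real i"] by simp
qed auto

lemma nn_integral_radial_annulus:
  fixes l r :: real
  assumes "0 < l" "l \<le> r"
  shows "(\<integral>\<^sup>+ z. ennreal (norm (z::'a::euclidean_space) powr (- real DIM('a)) * indicator {l..r} (norm z)) \<partial>lborel)
    = ennreal (sphere_area DIM('a) * ln (r / l))"
proof -
  let ?n = "DIM('a)"
  let ?w = "sphere_area ?n"
  have "(\<integral>\<^sup>+ z. ennreal (norm (z::'a) powr (- real ?n) * indicator {l..r} (norm z)) \<partial>lborel)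
     = (\<integral>\<^sup>+ s. ennreal (s powr (- real ?n) * indicator {l..r} s) \<partial>distr lborel borel (norm :: 'a \<Rightarrow> real))"
    by (subst nn_integral_distr) auto
  also have "\<dots> = (\<integral>\<^sup>+ s. ennreal (?w * s ^ (?n - 1) * indicator {0..} s) * ennreal (s powr (- real ?n) * indicator {l..r} s) \<partial>lborel)"
    unfolding distr_norm_lborel by (subst nn_integral_density) auto
  also have "\<dots> = (\<integral>\<^sup>+ s. ennreal (?w / s) * indicator {l..r} s \<partial>lborel)"
  proof (intro nn_integral_cong)
    fix s
    show "ennreal (?w * s ^ (?n - 1) * indicator {0..} s) * ennreal (s powr (- real ?n) * indicator {l..r} s)
        = ennreal (?w / s) * indicator {l..r} s"
    proof (cases "s \<in> {l..r}")
      case True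
      then have s: "s > 0" using assms by auto
      then have "s ^ (?n - 1) * s powr (- real ?n) = 1 / s"
        by (simp add: powr_minus powr_realpow power_diff field_simps)
      then have "?w * s ^ (?n - 1) * s powr (- real ?n) = ?w / s"
        by (simp add: mult.assoc)
      with True s show ?thesis
        using sphere_area_pos[of ?n] by (auto simp flip: ennreal_mult'')
    qed auto
  qed
  also have "\<dots> = ?w * ln r - ?w * ln l"
    using assms sphere_area_pos[of ?n]
    by (intro nn_integral_FTC_Icc) (auto intro!: derivative_eq_intros divide_nonneg_pos simp: field_simps)
  also have "?w * ln r - ?w * ln l = ?w * ln (r / l)"
    using assms by (simp add: ln_div right_diff_distrib)
  finally show ?thesis .
qed

subsection \<open>Kernel estimates\<close>

text \<open>The factor \<open>2 powr a\<close> times the sum of the geometric series with ratio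
  \<open>2 powr (a - \<kappa>)\<close>, as it arises from summing over dyadic shells.\<close>

definition dyadic_const :: "real \<Rightarrow> real \<Rightarrow> real" where
  "dyadic_const a \<kappa> = 2 powr a / (1 - 2 powr (a - \<kappa>))"

lemma dyadic_const_pos: "a < \<kappa> \<Longrightarrow> dyadic_const a \<kappa> > 0"
  using powr_less_mono[of "a - \<kappa>" 0 2] by (simp add: dyadic_const_def)

lemma dyadic_bracket:
  fixes z \<rho> :: real
  assumes "0 < z" "z < \<rho>"
  obtains i :: nat where "\<rho> / 2 ^ Suc i \<le> z" "z < \<rho> / 2 ^ i"
proof -
  define u where "u = log 2 (\<rho> / z)"
  have u: "u > 0" "2 powr u = \<rho> / z" using assms by (auto simp: u_def)
  define i where "i = nat (\<lceil>u\<rceil> - 1)"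
  have i: "real i < u" "u \<le> real (Suc i)" using u(1) unfolding i_def by linarith+
  have "2 ^ i < \<rho> / z"
    using powr_less_mono[OF i(1), of 2] u(2) by (simp add: powr_realpow)
  moreover have "\<rho> / z \<le> 2 ^ Suc i"
    using powr_mono[OF i(2), of 2] u(2) by (simp add: powr_realpow del: power_Suc of_nat_Suc)
  ultimately show ?thesis using assms by (intro that[of i]) (auto simp: field_simps)
qed

text \<open>On the i-th dyadic shell the integrand is at most \<open>t i\<close>, and the growth
  condition bounds the mass of the ball around it; the products decay geometrically because
  \<open>a < \<kappa>\<close>. The measure is general, since both Lebesgue measure and averages over
  level sets are inserted.\<close>

lemma nn_integral_ball_powr_le:
  fixes N :: "'a::euclidean_space measure" and x :: 'a
  assumes N[measurable_cong]: "sets N = sets borel"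
    and "B \<ge> 0" "\<rho> > 0" "0 \<le> a" "a < \<kappa>"
    and ball: "\<And>r. 0 < r \<Longrightarrow> r \<le> \<rho> \<Longrightarrow> emeasure N (ball x r) \<le> ennreal (B * r powr \<kappa>)"
  shows "(\<integral>\<^sup>+ y. ennreal (norm (x - y) powr (- a) * indicator {..<\<rho>} (norm (x - y))) \<partial>N)
    \<le> ennreal (B * dyadic_const a \<kappa> * \<rho> powr (\<kappa> - a))"
proof -
  define t where "t i = (\<rho> / 2 ^ Suc i) powr (- a)" for i :: nat
  have t0: "t i \<ge> 0" for i by (simp add: t_def)
  have [measurable]: "ball x r \<in> sets N" for r by (simp add: N)
  have pw: "ennreal (norm (x - y) powr (- a) * indicator {..<\<rho>} (norm (x - y)))
      \<le> (\<Sum>i. ennreal (t i) * indicator (ball x (\<rho> / 2 ^ i)) y)" (is "_ \<le> ?S") for y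
  proof (cases "0 < norm (x - y) \<and> norm (x - y) < \<rho>")
    case True
    then obtain i where i: "\<rho> / 2 ^ Suc i \<le> norm (x - y)" "norm (x - y) < \<rho> / 2 ^ i"
      using dyadic_bracket by metis
    have "norm (x - y) powr (- a) \<le> t i"
      unfolding t_def using i assms by (intro powr_mono2') auto
    then have "ennreal (norm (x - y) powr (- a) * indicator {..<\<rho>} (norm (x - y)))
        \<le> ennreal (t i) * indicator (ball x (\<rho> / 2 ^ i)) y"
      using i True by (simp add: dist_norm ennreal_leI)
    also have "\<dots> \<le> ?S"
      using sum_le_suminf[of "\<lambda>i. ennreal (t i) * indicator (ball x (\<rho> / 2 ^ i)) y" "{i}"] by (simp del: sum_mult_indicator)
    finally show ?thesis .
  \<comment> \<open>This covers \<open>y = x\<close> too, where the integrand is 0 since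
    \<open>0 powr _ = 0\<close>.\<close>
  qed (auto simp: indicator_def)
  define s where "s = 2 powr (a - \<kappa>)"
  have s: "0 < s" "s < 1" using powr_less_mono[of "a - \<kappa>" 0 2] assms by (auto simp: s_def)
  define K where "K = B * \<rho> powr (\<kappa> - a) * 2 powr a"
  have K0: "K \<ge> 0" using assms by (simp add: K_def)
  have c: "t i * (B * (\<rho> / 2 ^ i) powr \<kappa>) = K * s ^ i" for i
  proof -
    have [simp]: "2 ^ i = 2 powr real i" by (simp add: powr_realpow)
    have "t i = \<rho> powr (- a) * 2 powr (a * (i + 1))"
      unfolding t_def
      by (simp add: powr_divide powr_minus powr_mult powr_powr assms field_simps flip: powr_add)
    moreover have "(\<rho> / 2 ^ i) powr \<kappa> = \<rho> powr \<kappa> * 2 powr (- \<kappa> * i)"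
      using assms by (simp add: powr_divide powr_powr powr_minus field_simps)
    moreover have "s ^ i = 2 powr ((a - \<kappa>) * i)"
      using s(1) by (simp add: s_def powr_powr flip: powr_realpow)
    moreover have "\<rho> powr (\<kappa> - a) = \<rho> powr \<kappa> * \<rho> powr (- a)"
      by (simp flip: powr_add)
    moreover have "2 powr (a * (i + 1)) * 2 powr (- \<kappa> * i) = 2 powr a * 2 powr ((a - \<kappa>) * i)"
      by (simp add: algebra_simps flip: powr_add)
    ultimately show ?thesis by (simp add: K_def mult_ac)
  qed
  have "(\<integral>\<^sup>+ y. ennreal (norm (x - y) powr (- a) * indicator {..<\<rho>} (norm (x - y))) \<partial>N)
      \<le> (\<integral>\<^sup>+ y. (\<Sum>i. ennreal (t i) * indicator (ball x (\<rho> / 2 ^ i)) y) \<partial>N)"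
    by (intro nn_integral_mono pw)
  also have "\<dots> = (\<Sum>i. ennreal (t i) * emeasure N (ball x (\<rho> / 2 ^ i)))"
    by (subst nn_integral_suminf) (auto simp: nn_integral_cmult_indicator)
  also have "\<dots> \<le> (\<Sum>i. ennreal (K * s ^ i))"
  proof (intro suminf_le allI)
    fix i
    have "\<rho> / 2 ^ i \<le> \<rho>" using assms by (simp add: field_simps)
    then have "ennreal (t i) * emeasure N (ball x (\<rho> / 2 ^ i))
        \<le> ennreal (t i) * ennreal (B * (\<rho> / 2 ^ i) powr \<kappa>)"
      using assms by (intro mult_left_mono ball) auto
    also have "\<dots> = ennreal (K * s ^ i)"
      using t0 by (simp only: c flip: ennreal_mult')
    finally show "ennreal (t i) * emeasure N (ball x (\<rho> / 2 ^ i)) \<le> ennreal (K * s ^ i)" .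
  qed auto
  also have "\<dots> = ennreal (K * (1 / (1 - s)))"
    using s K0 by (intro suminf_ennreal_eq sums_mult geometric_sums) auto
  also have "K * (1 / (1 - s)) = B * dyadic_const a \<kappa> * \<rho> powr (\<kappa> - a)"
    by (simp add: K_def s_def dyadic_const_def)
  finally show ?thesis .
qed

lemma nn_integral_ball_powr_lborel_le:
  fixes x :: "'a::euclidean_space"
  assumes "\<rho> > 0" "0 \<le> a" "a < real DIM('a)"
  shows "(\<integral>\<^sup>+ y. ennreal (norm (x - y) powr (- a) * indicator {..<\<rho>} (norm (x - y))) \<partial>lborel)
    \<le> ennreal (unit_ball_vol DIM('a) * dyadic_const a DIM('a) * \<rho> powr (real DIM('a) - a))"
  using assms by (intro nn_integral_ball_powr_le) (auto simp: emeasure_ball powr_realpow)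

text \<open>Half-open shells make the splitting in \<open>kern_split\<close> exact. Taking
  \<open>l = 0\<close> gives the kernel on a ball, with value 0 at the origin.\<close>

definition kern :: "real \<Rightarrow> real \<Rightarrow> real \<Rightarrow> 'a::euclidean_space \<Rightarrow> real" where
  "kern e l r z = norm z powr (- e) * indicator {l..<r} (norm z)"

lemma kern_measurable [measurable]: "kern e l r \<in> borel_measurable borel"
  unfolding kern_def[abs_def] by measurable

lemma kern_nonneg [simp]: "kern e l r z \<ge> 0"
  by (simp add: kern_def)

lemma kern_split: "l \<le> \<rho> \<Longrightarrow> \<rho> \<le> r \<Longrightarrow> kern e l r z = kern e \<rho> r z + kern e l \<rho> z"
  by (auto simp: kern_def indicator_def)

lemma kern_le: "0 < l \<Longrightarrow> 0 \<le> e \<Longrightarrow> kern e l r z \<le> l powr (- e)"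
  by (auto simp: kern_def indicator_def intro: powr_mono2')

text \<open>The kernel on the dual side of the pairing. Where the average diverges,
  \<open>enn2real\<close> yields 0; in the cases used this happens at most on a null set
  (\<open>H_bounded\<close>, \<open>H_ball_AE\<close>).\<close>

definition kavg :: "'a::euclidean_space measure \<Rightarrow> real \<Rightarrow> real \<Rightarrow> real \<Rightarrow> 'a \<Rightarrow> real" where
  "kavg P e l r y = enn2real (\<integral>\<^sup>+ x. ennreal (kern e l r (x - y)) \<partial>P)"

lemma kavg_nonneg [simp]: "kavg P e l r y \<ge> 0"
  by (simp add: kavg_def)

lemma powr_add_le_double:
  fixes a b s :: real
  assumes "a \<ge> 0" "b \<ge> 0" "s \<ge> 0"
  shows "(a + b) powr s \<le> 2 powr s * (a powr s + b powr s)"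
proof -
  have "(a + b) powr s \<le> (2 * max a b) powr s"
    using assms by (intro powr_mono2) auto
  also have "\<dots> = 2 powr s * (max a b) powr s"
    using assms by (simp add: powr_mult)
  also have "(max a b) powr s \<le> a powr s + b powr s"
    by (simp add: max_def)
  finally show ?thesis by simp
qed

text \<open>The coefficient 1 of \<open>G powr q\<close> is the point: a larger one would spoil the
  sharp constant. The mean value theorem puts the whole loss into terms containing
  \<open>X\<close>.\<close>

lemma powr_add_le_expand:
  fixes G X q :: real
  assumes G: "G \<ge> 0" and X: "X \<ge> 0" and q: "q > 1"
  shows "(G + X) powr q \<le> G powr q + q * 2 powr (q - 1) * (G powr (q - 1) * X + X powr q)"
proof (cases "X = 0")
  case False
  then have X0: "X > 0" using X by simp
  have "\<exists>l z. G < z \<and> z < G + X \<and> DERIV (\<lambda>t. t powr q) z :> l \<and> (G + X) powr q - G powr q = (G + X - G) * l"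
  proof (rule MVT)
    show "continuous_on {G..G + X} (\<lambda>t. t powr q)"
      using G q by (intro continuous_on_powr') (auto intro: continuous_intros)
    show "(\<lambda>t. t powr q) differentiable at x" if "G < x" for x
      using that G has_real_derivative_powr[of x q] by (auto simp: real_differentiable_def)
  qed (use X0 in auto)
  then obtain l z where z: "G < z" "z < G + X" "DERIV (\<lambda>t. t powr q) z :> l" "(G + X) powr q - G powr q = X * l"
    by auto
  moreover have "DERIV (\<lambda>t. t powr q) z :> q * z powr (q - 1)"
    using z G by (intro has_real_derivative_powr) auto
  ultimately have l: "l = q * z powr (q - 1)" using DERIV_unique by blast
  have "z powr (q - 1) \<le> (G + X) powr (q - 1)"
    using z G q by (intro powr_mono2) auto
  also have "\<dots> \<le> 2 powr (q - 1) * (G powr (q - 1) + X powr (q - 1))"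
    using G X q by (intro powr_add_le_double) auto
  finally have "X * (q * z powr (q - 1)) \<le> X * (q * (2 powr (q - 1) * (G powr (q - 1) + X powr (q - 1))))"
    using X0 q by (intro mult_left_mono) auto
  also have "\<dots> = q * 2 powr (q - 1) * (G powr (q - 1) * X + X powr q)"
    using X0 by (simp add: algebra_simps powr_diff)
  finally show ?thesis using z l by simp
qed auto

subsection \<open>Averages of the Riesz kernel\<close>

text \<open>\<open>P\<close> stands for the normalised restriction of the given measure to a level
  set. The exponent \<open>q\<close> is dual to \<open>p\<close>, and \<open>e * q = n\<close> makes
  the q-th power of the kernel the borderline power \<open>- n\<close>, whence the
  logarithm.\<close>

locale radial_averages =
  fixes P :: "'a::euclidean_space measure" and n d e p q w :: real
  assumes n: "n = real DIM('a)" and w: "w = sphere_area DIM('a)"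
    and d_pos: "0 < d" and d_less: "d < n"
    and e_def: "e = n - d" and p_def: "p = n / d" and q_def: "q = n / e"
    and sets_P [measurable_cong]: "sets P = sets borel"
    and emeasure_P: "emeasure P UNIV = 1"
begin

lemma e_pos: "0 < e" and e_less: "e < n"
  using d_pos d_less by (auto simp: e_def)

lemma pq: "p > 1" "q > 1" "1 / p + 1 / q = 1"
  using d_pos d_less by (auto simp: e_def p_def q_def field_simps)

lemma eq: "e * q = n" "e * (q - 1) = d" "q / p = q - 1"
  using d_pos d_less by (auto simp: e_def p_def q_def field_simps)

lemma w_pos: "w > 0"
  unfolding w by (intro sphere_area_pos) auto

definition C3 where "C3 = unit_ball_vol n * dyadic_const e n"

lemma C3_pos: "C3 > 0"
  unfolding C3_def by (intro mult_pos_pos dyadic_const_pos e_less unit_ball_vol_pos) (auto simp: n)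

lemma kern_powr_q: "kern e l r z powr q = norm z powr (- n) * indicator {l..<r} (norm z)"
  by (auto simp: kern_def indicator_def powr_powr eq(1))

lemma space_P [simp]: "space P = UNIV"
  using sets_eq_imp_space_eq[OF sets_P] by simp

sublocale finite_measure P
  by standard (simp add: emeasure_P)

sublocale pair_sigma_finite P "lborel :: 'a measure"
  by standard

abbreviation "H \<equiv> kavg P e"

lemma H_measurable [measurable]: "H l r \<in> borel_measurable borel"
  unfolding kavg_def[abs_def] by measurable

lemma H_bounded:
  assumes "0 < l"
  shows "(\<integral>\<^sup>+ x. ennreal (kern e l r (x - y)) \<partial>P) = ennreal (H l r y)" "H l r y \<le> l powr (- e)"
proof -
  have "(\<integral>\<^sup>+ x. ennreal (kern e l r (x - y)) \<partial>P) \<le> (\<integral>\<^sup>+ x. ennreal (l powr (- e)) \<partial>P)"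
    using assms e_pos by (intro nn_integral_mono ennreal_leI kern_le) auto
  then have *: "(\<integral>\<^sup>+ x. ennreal (kern e l r (x - y)) \<partial>P) \<le> ennreal (l powr (- e))"
    by (simp add: emeasure_P)
  then show "(\<integral>\<^sup>+ x. ennreal (kern e l r (x - y)) \<partial>P) = ennreal (H l r y)"
    unfolding kavg_def by (intro ennreal_enn2real[symmetric]) (auto intro: le_less_trans)
  show "H l r y \<le> l powr (- e)"
    unfolding kavg_def using * by (intro enn2real_leI) auto
qed

lemma nn_integral_swap_kernel:
  fixes g :: "'a \<Rightarrow> real"
  assumes [measurable]: "g \<in> borel_measurable borel"
  shows "(\<integral>\<^sup>+ y. \<integral>\<^sup>+ x. ennreal (g (x - y)) \<partial>P \<partial>lborel) = (\<integral>\<^sup>+ z. ennreal (g z) \<partial>lborel)"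
proof -
  have "(\<integral>\<^sup>+ y. \<integral>\<^sup>+ x. ennreal (g (x - y)) \<partial>P \<partial>lborel) = (\<integral>\<^sup>+ x. \<integral>\<^sup>+ y. ennreal (g (x - y)) \<partial>lborel \<partial>P)"
    by (rule Fubini') measurable
  also have "\<dots> = (\<integral>\<^sup>+ z. ennreal (g z) \<partial>lborel)"
    by (subst nn_integral_lborel_reflect[of "\<lambda>z. ennreal (g z)"]) (auto simp: emeasure_P)
  finally show ?thesis .
qed

text \<open>Jensen moves the q-th power under the average; Fubini and translation invariance then
  remove \<open>P\<close>. What remains is the radial integral of \<open>norm z powr (- n)\<close>,
  so the constant is exactly \<open>w\<close> whatever \<open>P\<close> is.\<close>

lemma H_annulus:
  assumes "0 < l" "l \<le> r"
  shows "(\<integral>\<^sup>+ y. ennreal (H l r y powr q) \<partial>lborel) \<le> ennreal (w * ln (r / l))"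
proof -
  have "ennreal (H l r y powr q) \<le> (\<integral>\<^sup>+ x. ennreal (kern e l r (x - y) powr q) \<partial>P)" for y
    using nn_integral_Holder_powr[of "\<lambda>x. kern e l r (x - y)" P "\<lambda>_. 1" p q 1] pq
    by (simp add: emeasure_P kavg_def)
  then have "(\<integral>\<^sup>+ y. ennreal (H l r y powr q) \<partial>lborel)
    \<le> (\<integral>\<^sup>+ y. \<integral>\<^sup>+ x. ennreal (kern e l r (x - y) powr q) \<partial>P \<partial>lborel)"
    by (intro nn_integral_mono)
  also have "\<dots> = (\<integral>\<^sup>+ z. ennreal (kern e l r (z::'a) powr q) \<partial>lborel)"
    by (rule nn_integral_swap_kernel) measurable
  also have "\<dots> \<le> (\<integral>\<^sup>+ z. ennreal (norm (z::'a) powr (- n) * indicator {l..r} (norm z)) \<partial>lborel)"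
    unfolding kern_powr_q by (intro nn_integral_mono ennreal_leI mult_left_mono) (auto simp: indicator_def)
  also have "\<dots> = ennreal (w * ln (r / l))"
    unfolding n w by (rule nn_integral_radial_annulus[OF assms])
  finally show ?thesis .
qed

lemma kern_ball_le:
  assumes "0 < \<rho>"
  shows "(\<integral>\<^sup>+ y. \<integral>\<^sup>+ x. ennreal (kern e 0 \<rho> (x - y)) \<partial>P \<partial>lborel) \<le> ennreal (C3 * \<rho> powr d)"
proof -
  have "(\<integral>\<^sup>+ y. \<integral>\<^sup>+ x. ennreal (kern e 0 \<rho> (x - y)) \<partial>P \<partial>lborel)
     = (\<integral>\<^sup>+ z. ennreal (kern e 0 \<rho> (z::'a)) \<partial>lborel)"
    by (rule nn_integral_swap_kernel) measurable
  also have "\<dots> = (\<integral>\<^sup>+ z. ennreal (norm (0 - (z::'a)) powr (- e) * indicator {..<\<rho>} (norm (0 - z))) \<partial>lborel)"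
    unfolding kern_def by (intro nn_integral_cong) (auto simp: indicator_def)
  also have "\<dots> \<le> ennreal (unit_ball_vol n * dyadic_const e n * \<rho> powr (n - e))"
    using assms e_pos e_less unfolding n by (intro nn_integral_ball_powr_lborel_le) auto
  also have "n - e = d" by (simp add: e_def)
  finally show ?thesis unfolding C3_def .
qed

lemma H_ball_AE:
  assumes "0 < \<rho>"
  shows "AE y in lborel. (\<integral>\<^sup>+ x. ennreal (kern e 0 \<rho> (x - y)) \<partial>P) = ennreal (H 0 \<rho> y)"
proof -
  have "(\<integral>\<^sup>+ y. \<integral>\<^sup>+ x. ennreal (kern e 0 \<rho> (x - y)) \<partial>P \<partial>lborel) \<noteq> \<infinity>"
    using kern_ball_le[OF assms] by (auto simp: top_unique)
  then have "AE y in lborel. (\<integral>\<^sup>+ x. ennreal (kern e 0 \<rho> (x - y)) \<partial>P) \<noteq> \<infinity>"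
    by (intro nn_integral_noteq_infinite) measurable
  then show ?thesis
    by eventually_elim (simp add: kavg_def less_top)
qed

lemma H_ball_le:
  assumes "0 < \<rho>"
  shows "(\<integral>\<^sup>+ y. ennreal (H 0 \<rho> y) \<partial>lborel) \<le> ennreal (C3 * \<rho> powr d)"
proof -
  have "(\<integral>\<^sup>+ y. ennreal (H 0 \<rho> y) \<partial>lborel) = (\<integral>\<^sup>+ y. \<integral>\<^sup>+ x. ennreal (kern e 0 \<rho> (x - y)) \<partial>P \<partial>lborel)"
    by (rule nn_integral_cong_AE) (use H_ball_AE[OF assms] in eventually_elim, simp)
  then show ?thesis using kern_ball_le[OF assms] by simp
qed

text \<open>A perturbation \<open>X\<close> of the outer kernel costs only an additive constant. The
  outer kernel is at most \<open>\<rho> powr (- e)\<close>, so its power \<open>q - 1\<close> is at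
  most \<open>\<rho> powr (- d)\<close>, which cancels the scale in the integral bound for
  \<open>X\<close>; hence the cross term is bounded independently of \<open>\<rho>\<close>.
  Hoelder's inequality against \<open>f\<close> concludes.\<close>

lemma dual_pairing_le:
  fixes f X :: "'a \<Rightarrow> real"
  assumes [measurable]: "f \<in> borel_measurable borel" "X \<in> borel_measurable borel"
    and nn: "\<And>y. 0 \<le> f y" "\<And>y. 0 \<le> X y"
    and f: "(\<integral>\<^sup>+ y. ennreal (f y powr p) \<partial>lborel) \<le> 1"
    and X: "(\<integral>\<^sup>+ y. ennreal (X y) \<partial>lborel) \<le> ennreal (a * \<rho> powr d)"
      "(\<integral>\<^sup>+ y. ennreal (X y powr q) \<partial>lborel) \<le> ennreal b"
    and ab: "0 < a" "0 \<le> b" and \<rho>: "0 < \<rho>" "\<rho> \<le> R"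
  shows "(\<integral>\<^sup>+ y. ennreal (f y * (H \<rho> R y + X y)) \<partial>lborel)
    \<le> ennreal ((w * ln (R / \<rho>) + q * 2 powr (q - 1) * (a + b)) powr (1 / q))"
proof -
  define K where "K = q * 2 powr (q - 1)"
  have K: "K > 0" using pq by (simp add: K_def)
  have L: "w * ln (R / \<rho>) \<ge> 0" using w_pos \<rho> by simp
  have pw: "ennreal ((H \<rho> R y + X y) powr q)
      \<le> ennreal (H \<rho> R y powr q) + (ennreal (K * \<rho> powr (- d)) * ennreal (X y) + ennreal K * ennreal (X y powr q))" for y
  proof -
    have "H \<rho> R y powr (q - 1) \<le> (\<rho> powr (- e)) powr (q - 1)"
      using H_bounded(2)[OF \<rho>(1)] pq by (intro powr_mono2) auto
    also have "\<dots> = \<rho> powr (- d)" by (simp add: powr_powr eq)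
    finally have "H \<rho> R y powr (q - 1) * X y \<le> \<rho> powr (- d) * X y"
      using nn by (intro mult_right_mono) auto
    then have "(H \<rho> R y + X y) powr q \<le> H \<rho> R y powr q + K * (\<rho> powr (- d) * X y + X y powr q)"
      using powr_add_le_expand[of "H \<rho> R y" "X y" q] nn pq K
      unfolding K_def[symmetric] by (smt (verit) kavg_nonneg mult_left_mono)
    then show ?thesis using K nn
      by (simp add: algebra_simps flip: ennreal_mult' ennreal_plus)
  qed
  have "(\<integral>\<^sup>+ y. ennreal ((H \<rho> R y + X y) powr q) \<partial>lborel)
     \<le> (\<integral>\<^sup>+ y. ennreal (H \<rho> R y powr q) + (ennreal (K * \<rho> powr (- d)) * ennreal (X y) + ennreal K * ennreal (X y powr q)) \<partial>lborel)"
    by (intro nn_integral_mono pw)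
  also have "\<dots> = (\<integral>\<^sup>+ y. ennreal (H \<rho> R y powr q) \<partial>lborel)
     + (ennreal (K * \<rho> powr (- d)) * (\<integral>\<^sup>+ y. ennreal (X y) \<partial>lborel) + ennreal K * (\<integral>\<^sup>+ y. ennreal (X y powr q) \<partial>lborel))"
    by (simp add: nn_integral_add nn_integral_cmult)
  also have "\<dots> \<le> ennreal (w * ln (R / \<rho>)) + (ennreal (K * \<rho> powr (- d)) * ennreal (a * \<rho> powr d) + ennreal K * ennreal b)"
    using H_annulus[OF \<rho>] X by (intro add_mono mult_left_mono) auto
  also have "\<dots> = ennreal (w * ln (R / \<rho>) + K * (a + b))"
    using K ab L \<rho> by (simp add: powr_minus field_simps flip: ennreal_mult' ennreal_plus)
  finally have "(\<integral>\<^sup>+ y. ennreal ((H \<rho> R y + X y) powr q) \<partial>lborel) \<le> ennreal (w * ln (R / \<rho>) + K * (a + b))" .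
  moreover have "w * ln (R / \<rho>) + K * (a + b) > 0"
    using K ab L by (intro add_nonneg_pos) auto
  ultimately have "(\<integral>\<^sup>+ y. ennreal (f y * (H \<rho> R y + X y)) \<partial>lborel)
      \<le> ennreal (1 powr (1 / p) * (w * ln (R / \<rho>) + K * (a + b)) powr (1 / q))"
    using nn pq f by (intro nn_integral_Holder) auto
  then show ?thesis by (simp add: K_def)
qed

text \<open>Average the level inequality over \<open>P\<close> and interchange the integrals. That
  \<open>H 0 \<rho>\<close> is the true average only almost everywhere is enough under the
  integral.\<close>

lemma level_le_dual_pairing:
  fixes f :: "'a \<Rightarrow> real"
  assumes [measurable]: "f \<in> borel_measurable borel"
    and nn: "\<And>y. 0 \<le> f y"
    and level: "AE x in P. ennreal s \<le> (\<integral>\<^sup>+ y. ennreal (kern e 0 R (x - y) * f y) \<partial>lborel)"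
    and \<rho>: "0 < \<rho>" "\<rho> \<le> R"
  shows "ennreal s \<le> (\<integral>\<^sup>+ y. ennreal (f y * (H \<rho> R y + H 0 \<rho> y)) \<partial>lborel)"
proof -
  have "ennreal s = (\<integral>\<^sup>+ x. ennreal s \<partial>P)" by (simp add: emeasure_P)
  also have "\<dots> \<le> (\<integral>\<^sup>+ x. \<integral>\<^sup>+ y. ennreal (kern e 0 R (x - y) * f y) \<partial>lborel \<partial>P)"
    by (intro nn_integral_mono_AE level)
  also have "\<dots> = (\<integral>\<^sup>+ y. \<integral>\<^sup>+ x. ennreal (kern e 0 R (x - y) * f y) \<partial>P \<partial>lborel)"
    by (rule Fubini'[symmetric]) measurable
  also have "\<dots> = (\<integral>\<^sup>+ y. ennreal (f y * (H \<rho> R y + H 0 \<rho> y)) \<partial>lborel)"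
  proof (rule nn_integral_cong_AE)
    show "AE y in lborel. (\<integral>\<^sup>+ x. ennreal (kern e 0 R (x - y) * f y) \<partial>P) = ennreal (f y * (H \<rho> R y + H 0 \<rho> y))"
      using H_ball_AE[OF \<rho>(1)]
    proof eventually_elim
      case (elim y)
      have "(\<integral>\<^sup>+ x. ennreal (kern e 0 R (x - y) * f y) \<partial>P)
        = (\<integral>\<^sup>+ x. ennreal (f y) * (ennreal (kern e \<rho> R (x - y)) + ennreal (kern e 0 \<rho> (x - y))) \<partial>P)"
        using \<rho> nn by (intro nn_integral_cong)
          (simp add: kern_split[of 0 \<rho> R] mult.commute flip: ennreal_plus ennreal_mult')
      also have "\<dots> = ennreal (f y) * (ennreal (H \<rho> R y) + ennreal (H 0 \<rho> y))"
        by (simp add: nn_integral_cmult nn_integral_add H_bounded(1)[OF \<rho>(1)] elim)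
      finally show ?case using nn by (simp flip: ennreal_plus ennreal_mult')
    qed
  qed
  finally show ?thesis .
qed

end

section \<open>Averages under a growth condition on balls\<close>

text \<open>The number \<open>\<delta>\<close> is the effective radius of the averaged set, whose
  measure is \<open>\<delta> powr lam\<close>; normalising by it turns the growth bound
  \<open>A * r powr lam\<close> into the scale-invariant one assumed here.\<close>

locale frostman_average = radial_averages P n d e p q w
  for P :: "'a::euclidean_space measure" and n d e p q w +
  fixes lam A \<delta> :: real
  assumes lam: "0 < lam" and A: "0 < A" and \<delta>: "0 < \<delta>"
    and ball_le: "\<And>x r. 0 < r \<Longrightarrow> emeasure P (ball x r) \<le> ennreal (A * (r / \<delta>) powr lam)"
begin

text \<open>The kernel is split as \<open>norm z powr (- a) * norm z powr (- b)\<close> with \<open>b > 0\<close> so small that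
  \<open>norm z powr (- b * p)\<close> is still integrable against \<open>P\<close>.\<close>

definition "b = min (lam / p) e / 2"
definition "a = e - b"

definition "C4 = (A * dyadic_const (b * p) lam) powr (q / p) * (unit_ball_vol n * dyadic_const (a * q) n)"

lemma ab: "0 < b" "b * p < lam" "0 < a" "a * q < n"
proof -
  show b: "0 < b" using lam pq e_pos by (simp add: b_def)
  have "x / 2 < x" if "0 < x" for x :: real using that by simp
  moreover have "0 < min (lam / p) e" using lam pq e_pos by simp
  ultimately have "b < min (lam / p) e" unfolding b_def by blast
  then have "b < lam / p" "b < e" unfolding min_less_iff_conj by blast+
  then show "b * p < lam" "0 < a" using pq by (auto simp: a_def pos_less_divide_eq)
  have "a * q < e * q" using b pq by (intro mult_strict_right_mono) (auto simp: a_def)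
  then show "a * q < n" by (simp add: eq)
qed

lemma C4_pos: "C4 > 0"
  unfolding C4_def
  using ab A dyadic_const_pos[of "b * p" lam] dyadic_const_pos[of "a * q" n] by (simp add: n)

text \<open>Hoelder with respect to \<open>P\<close>: the factor with exponent \<open>b\<close> is
  controlled by the growth of \<open>P\<close>, since \<open>b * p < lam\<close>, and the factor
  with exponent \<open>a\<close> by Lebesgue integration, since \<open>a * q < n\<close>. All powers
  of \<open>\<delta>\<close> cancel because \<open>(a + b) * q = n\<close>, so \<open>C4\<close> is
  uniform over the level sets.\<close>

lemma H_inner: "(\<integral>\<^sup>+ y. ennreal (H 0 \<delta> y powr q) \<partial>lborel) \<le> ennreal C4"
proof -
  define D where "D = A * dyadic_const (b * p) lam"
  have D: "D > 0" using ab A dyadic_const_pos[of "b * p" lam] by (simp add: D_def)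
  define B where "B = D * \<delta> powr (- b * p)"
  have B: "B > 0" using D \<delta> by (simp add: B_def)
  have "(\<integral>\<^sup>+ x. ennreal (kern b 0 \<delta> (x - y) powr p) \<partial>P) \<le> ennreal B" for y
  proof -
    have "(\<integral>\<^sup>+ x. ennreal (kern b 0 \<delta> (x - y) powr p) \<partial>P)
      = (\<integral>\<^sup>+ x. ennreal (norm (y - x) powr (- (b * p)) * indicator {..<\<delta>} (norm (y - x))) \<partial>P)"
      by (intro nn_integral_cong) (auto simp: kern_def indicator_def powr_powr norm_minus_commute)
    also have "\<dots> \<le> ennreal (A * \<delta> powr (- lam) * dyadic_const (b * p) lam * \<delta> powr (lam - b * p))"
    proof (rule nn_integral_ball_powr_le)
      show "emeasure P (ball y r) \<le> ennreal (A * \<delta> powr (- lam) * r powr lam)" if "0 < r" "r \<le> \<delta>" for r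
        using ball_le[OF that(1), of y] that \<delta> by (simp add: powr_divide powr_minus field_simps)
    qed (use ab A \<delta> pq sets_P in auto)
    also have "A * \<delta> powr (- lam) * dyadic_const (b * p) lam * \<delta> powr (lam - b * p) = B"
      using \<delta> by (simp add: B_def D_def powr_diff powr_minus field_simps)
    finally show ?thesis .
  qed
  moreover have kk: "kern a 0 \<delta> z * kern b 0 \<delta> z = kern e 0 \<delta> z" for z :: 'a
    by (auto simp: kern_def indicator_def a_def simp flip: powr_add)
  ultimately have "ennreal (H 0 \<delta> y powr q)
    \<le> ennreal (B powr (q / p)) * (\<integral>\<^sup>+ x. ennreal (kern a 0 \<delta> (x - y) powr q) \<partial>P)" for y
    using nn_integral_Holder_powr[of "\<lambda>x. kern a 0 \<delta> (x - y)" P "\<lambda>x. kern b 0 \<delta> (x - y)" p q B] pq B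
    by (simp add: kk kavg_def)
  then have "(\<integral>\<^sup>+ y. ennreal (H 0 \<delta> y powr q) \<partial>lborel)
    \<le> (\<integral>\<^sup>+ y. ennreal (B powr (q / p)) * (\<integral>\<^sup>+ x. ennreal (kern a 0 \<delta> (x - y) powr q) \<partial>P) \<partial>lborel)"
    by (intro nn_integral_mono)
  also have "\<dots> = ennreal (B powr (q / p)) * (\<integral>\<^sup>+ z. ennreal (kern a 0 \<delta> (z::'a) powr q) \<partial>lborel)"
    by (subst nn_integral_cmult) (auto simp: nn_integral_swap_kernel[of "\<lambda>z. kern a 0 \<delta> z powr q"])
  also have "(\<integral>\<^sup>+ z. ennreal (kern a 0 \<delta> (z::'a) powr q) \<partial>lborel)
     = (\<integral>\<^sup>+ z. ennreal (norm (0 - (z::'a)) powr (- (a * q)) * indicator {..<\<delta>} (norm (0 - z))) \<partial>lborel)"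
    by (intro nn_integral_cong) (auto simp: kern_def indicator_def powr_powr)
  also have "\<dots> \<le> ennreal (unit_ball_vol n * dyadic_const (a * q) n * \<delta> powr (n - a * q))"
    using ab pq \<delta> unfolding n by (intro nn_integral_ball_powr_lborel_le) auto
  also have "ennreal (B powr (q / p)) * \<dots> = ennreal C4"
  proof -
    have "B powr (q / p) = D powr (q / p) * \<delta> powr (- (b * q))"
      using D \<delta> pq by (simp add: B_def powr_mult powr_powr)
    moreover have "\<delta> powr (- (b * q)) * \<delta> powr (n - a * q) = 1"
    proof -
      have "- (b * q) + (n - a * q) = 0" using eq(1) by (simp add: a_def algebra_simps)
      then show ?thesis using \<delta> by (simp flip: powr_add)
    qed
    ultimately have "B powr (q / p) * (unit_ball_vol n * dyadic_const (a * q) n * \<delta> powr (n - a * q)) = C4"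
      unfolding C4_def D_def[symmetric] by simp
    then show ?thesis by (simp flip: ennreal_mult')
  qed
  finally show ?thesis by (simp add: mult_left_mono)
qed

text \<open>The crude factor \<open>2 powr q\<close> is harmless: \<open>two_level_bound\<close>
  uses this estimate with a weight that compensates the logarithm, so it only affects an additive
  constant.\<close>

lemma H_ball_powr_le:
  assumes "\<delta> \<le> \<rho>"
  shows "(\<integral>\<^sup>+ y. ennreal (H 0 \<rho> y powr q) \<partial>lborel) \<le> ennreal (2 powr q * (w * ln (\<rho> / \<delta>) + C4))"
proof -
  have L: "w * ln (\<rho> / \<delta>) \<ge> 0" using w_pos \<delta> assms by simp
  have "H 0 \<rho> y \<le> H \<delta> \<rho> y + H 0 \<delta> y" for y
  proof -
    have "(\<integral>\<^sup>+ x. ennreal (kern e 0 \<rho> (x - y)) \<partial>P)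
      = (\<integral>\<^sup>+ x. ennreal (kern e \<delta> \<rho> (x - y)) + ennreal (kern e 0 \<delta> (x - y)) \<partial>P)"
      using assms \<delta> by (intro nn_integral_cong) (simp add: kern_split[of 0 \<delta> \<rho>] flip: ennreal_plus)
    also have "\<dots> = ennreal (H \<delta> \<rho> y) + (\<integral>\<^sup>+ x. ennreal (kern e 0 \<delta> (x - y)) \<partial>P)"
      by (simp add: nn_integral_add H_bounded(1)[OF \<delta>])
    \<comment> \<open>Where the inner average is infinite, \<open>H 0 \<rho> y\<close> is 0 by the
      convention for \<open>enn2real\<close>, and the inequality still holds.\<close>
    finally show ?thesis
      unfolding kavg_def[of P e 0]
      by (cases "\<integral>\<^sup>+ x. ennreal (kern e 0 \<delta> (x - y)) \<partial>P") (auto simp flip: ennreal_plus)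
  qed
  then have "H 0 \<rho> y powr q \<le> (H \<delta> \<rho> y + H 0 \<delta> y) powr q" for y
    using pq by (intro powr_mono2) auto
  then have *: "H 0 \<rho> y powr q \<le> 2 powr q * (H \<delta> \<rho> y powr q + H 0 \<delta> y powr q)" for y
    using powr_add_le_double[of "H \<delta> \<rho> y" "H 0 \<delta> y" q] pq by (smt (verit) kavg_nonneg)
  have "(\<integral>\<^sup>+ y. ennreal (H 0 \<rho> y powr q) \<partial>lborel)
     \<le> (\<integral>\<^sup>+ y. ennreal (2 powr q) * (ennreal (H \<delta> \<rho> y powr q) + ennreal (H 0 \<delta> y powr q)) \<partial>lborel)"
    using * by (intro nn_integral_mono) (simp flip: ennreal_plus ennreal_mult')
  also have "\<dots> = ennreal (2 powr q) * ((\<integral>\<^sup>+ y. ennreal (H \<delta> \<rho> y powr q) \<partial>lborel) + (\<integral>\<^sup>+ y. ennreal (H 0 \<delta> y powr q) \<partial>lborel))"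
    by (simp add: nn_integral_add nn_integral_cmult)
  also have "\<dots> \<le> ennreal (2 powr q) * (ennreal (w * ln (\<rho> / \<delta>)) + ennreal C4)"
    by (intro mult_left_mono add_mono H_annulus H_inner assms \<delta>) auto
  also have "\<dots> = ennreal (2 powr q * (w * ln (\<rho> / \<delta>) + C4))"
    using L C4_pos by (simp flip: ennreal_plus ennreal_mult')
  finally show ?thesis .
qed

end

subsection \<open>Elementary inequalities for the level sets\<close>

text \<open>Hypothesis 1 makes \<open>I\<close> at most of order
  \<open>D powr (1 / q) * m * a powr (- 1 / p)\<close>, while hypothesis 2 asks for an increase of
  order \<open>D * (a + D) powr (- 1 / p)\<close>. Comparing the two gives
  \<open>D \<le> (2 * q * m) powr p * (1 + D / a)\<close>, and for \<open>a\<close> this large the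
  term with \<open>D / a\<close> is absorbed.\<close>

lemma two_level_real:
  fixes a c D I m p q :: real
  assumes pq: "p > 1" "q > 1" "1 / p + 1 / q = 1" and pos: "c > 0" "D \<ge> 1" "a > 0" "m > 0" "I \<ge> 0"
    and 1: "(c * a) powr (1 / q) + D powr (- 1 / q) * I \<le> (c * (a + m)) powr (1 / q)"
    and 2: "(c * (a + D)) powr (1 / q) \<le> (c * (a + m)) powr (1 / q) + I"
    and a: "a \<ge> 2 * (2 * q * m) powr p"
  shows "D \<le> 2 * (2 * q * m) powr p"
proof -
  \<comment> \<open>By homogeneity the constant \<open>c\<close> scales out.\<close>
  define \<gamma> where "\<gamma> = c powr (1 / q)"
  define J where "J = I / \<gamma>"
  have \<gamma>: "\<gamma> > 0" and I: "I = \<gamma> * J" using pos by (auto simp: \<gamma>_def J_def)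
  have split: "(c * a) powr (1 / q) = \<gamma> * a powr (1 / q)" "(c * (a + m)) powr (1 / q) = \<gamma> * (a + m) powr (1 / q)"
    "(c * (a + D)) powr (1 / q) = \<gamma> * (a + D) powr (1 / q)"
    using pos by (simp_all add: \<gamma>_def powr_mult)
  have "\<gamma> * (a powr (1 / q) + D powr (- 1 / q) * J) \<le> \<gamma> * (a + m) powr (1 / q)"
    using 1 unfolding I split by (simp add: distrib_left mult_ac)
  then have 1: "a powr (1 / q) + D powr (- 1 / q) * J \<le> (a + m) powr (1 / q)" using \<gamma> by simp
  have "\<gamma> * (a + D) powr (1 / q) \<le> \<gamma> * ((a + m) powr (1 / q) + J)"
    using 2 unfolding I split by (simp add: distrib_left mult_ac)
  then have 2: "(a + D) powr (1 / q) \<le> (a + m) powr (1 / q) + J" using \<gamma> by simp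
  have mvt: "\<exists>z. a < z \<and> z < a + h \<and> (a + h) powr (1 / q) - a powr (1 / q) = h * (1 / q * z powr (- 1 / p))" if "h > 0" for h
  proof -
    have "1 / q - 1 = - 1 / p" using pq by simp
    then have "((\<lambda>t. t powr (1 / q)) has_real_derivative 1 / q * x powr (- 1 / p)) (at x)" if "a \<le> x" for x
      using has_real_derivative_powr[of x "1 / q"] that pos by simp
    then show ?thesis using MVT2[of a "a + h" "\<lambda>t. t powr (1 / q)" "\<lambda>z. 1 / q * z powr (- 1 / p)"] that by auto
  qed
  obtain z where z: "a < z" "(a + m) powr (1 / q) - a powr (1 / q) = m * (1 / q * z powr (- 1 / p))"
    using mvt[of m] pos by auto
  have "1 / q * z powr (- 1 / p) \<le> 1 * a powr (- 1 / p)"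
    using z pos pq by (intro mult_mono powr_mono2') auto
  then have up: "(a + m) powr (1 / q) - a powr (1 / q) \<le> m * a powr (- 1 / p)"
    unfolding z(2) using pos by (intro mult_left_mono) auto
  obtain z where z: "a < z" "z < a + D" "(a + D) powr (1 / q) - a powr (1 / q) = D * (1 / q * z powr (- 1 / p))"
    using mvt[of D] pos by auto
  have "1 / q * (a + D) powr (- 1 / p) \<le> 1 / q * z powr (- 1 / p)"
    using z pos pq by (intro mult_left_mono powr_mono2') auto
  then have low: "D * (1 / q * (a + D) powr (- 1 / p)) \<le> (a + D) powr (1 / q) - a powr (1 / q)"
    unfolding z(3) by (rule mult_left_mono) (use pos in auto)
  have "D powr (1 / q) * (D powr (- 1 / q) * J) \<le> D powr (1 / q) * (m * a powr (- 1 / p))"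
    using 1 up pos by (intro mult_left_mono) auto
  then have J: "J \<le> D powr (1 / q) * (m * a powr (- 1 / p))"
    using pos by (simp flip: mult.assoc powr_add)
  \<comment> \<open>As \<open>D\<close> is at least 1, the increment from \<open>a\<close> to
    \<open>a + m\<close> obeys the same bound as \<open>J\<close>; this gives the factor 2
    below.\<close>
  have "1 \<le> D powr (1 / q)" using pos pq by (simp add: ge_one_powr_ge_zero)
  then have "m * a powr (- 1 / p) \<le> D powr (1 / q) * (m * a powr (- 1 / p))"
    using pos mult_right_mono[of 1 "D powr (1/q)" "m * a powr (- 1 / p)"] by simp
  with 2 low up J have *: "D * (1 / q * (a + D) powr (- 1 / p)) \<le> 2 * (D powr (1 / q) * (m * a powr (- 1 / p)))"
    by linarith
  have "D = D powr (1 / p) * D powr (1 / q)"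
    using pos pq by (simp flip: powr_add)
  then have "D * K = D powr (1 / q) * (D powr (1 / p) * K)" for K
    by (metis mult.assoc mult.commute)
  with * have "D powr (1 / q) * (D powr (1 / p) * (1 / q * (a + D) powr (- 1 / p))) \<le> D powr (1 / q) * (2 * (m * a powr (- 1 / p)))"
    by (simp only: mult.left_commute[of 2])
  moreover have "0 < D powr (1 / q)" using pos by simp
  ultimately have "D powr (1 / p) * (1 / q * (a + D) powr (- 1 / p)) \<le> 2 * (m * a powr (- 1 / p))"
    by (rule mult_left_le_imp_le)
  then have "D powr (1 / p) \<le> 2 * q * m * ((a + D) powr (1 / p) / a powr (1 / p))"
    using pos pq by (simp add: powr_minus field_simps)
  also have "(a + D) powr (1 / p) / a powr (1 / p) = (1 + D / a) powr (1 / p)"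
    using pos by (simp add: powr_divide[symmetric] add_divide_distrib)
  finally have "(D powr (1 / p)) powr p \<le> (2 * q * m * (1 + D / a) powr (1 / p)) powr p"
    using pq by (intro powr_mono2) auto
  then have "D \<le> (2 * q * m) powr p * (1 + D / a)"
    using pos pq by (simp add: powr_powr powr_mult)
  also have "\<dots> \<le> (2 * q * m) powr p + D / 2"
  proof -
    have "(2 * q * m) powr p / a \<le> 1 / 2" using a pos by (simp add: field_simps)
    then have "D * ((2 * q * m) powr p / a) \<le> D * (1 / 2)" using pos by (intro mult_left_mono) auto
    then show ?thesis by (simp add: algebra_simps)
  qed
  finally show ?thesis by simp
qed

text \<open>A layer-cake sum over the heights \<open>exp (- k)\<close>: growth
  \<open>exp (k / 2)\<close> of the number of indices uses up only half of the decay and leaves a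
  geometric series.\<close>

lemma suminf_le_of_superlevel_card:
  fixes h :: "nat \<Rightarrow> real"
  assumes h: "\<And>j. h j \<ge> 0" "\<And>j. h j \<le> B" and Q: "Q \<ge> 0"
    and J: "\<And>k::nat. finite {j. exp (- real k) \<le> h j}"
      "\<And>k::nat. real (card {j. exp (- real k) \<le> h j}) \<le> Q * exp (real k / 2)"
  shows "(\<Sum>j. ennreal (h j)) \<le> ennreal (max (exp 1) B * Q / (1 - exp (- 1 / 2)))"
proof -
  define C where "C = max (exp 1) B"
  have C: "C > 0" by (simp add: C_def less_max_iff_disj)
  define J where "J k = {j. exp (- real k) \<le> h j}" for k :: nat
  have pw: "ennreal (h j) \<le> (\<Sum>k. ennreal (C * exp (- real k)) * indicator (J k) j)" (is "_ \<le> ?S") for j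
  proof (cases "h j > 0")
    case True
    \<comment> \<open>All values above 1 get \<open>k = 0\<close>, where only the bound
      \<open>B\<close> is available; otherwise rounding up loses a factor \<open>exp 1\<close>.
      Hence the maximum in \<open>C\<close>.\<close>
    define k where "k = nat \<lceil>- ln (h j)\<rceil>"
    have "- real k \<le> ln (h j)" unfolding k_def by linarith
    then have jk: "exp (- real k) \<le> h j" using True by (simp add: ln_ge_iff)
    have "h j \<le> C * exp (- real k)"
    proof (cases "h j \<ge> 1")
      case True
      then have "k = 0" by (simp add: k_def)
      then show ?thesis using h(2)[of j] by (simp add: C_def)
    next
      case False
      then have "- ln (h j) > 0" using True by simp
      then have "ln (h j) \<le> 1 - real k" unfolding k_def by linarith
      then have "h j \<le> exp 1 * exp (- real k)"
        using True by (metis exp_ln exp_le_cancel_iff mult_exp_exp uminus_add_conv_diff add.commute)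
      also have "\<dots> \<le> C * exp (- real k)" by (intro mult_right_mono) (auto simp: C_def)
      finally show ?thesis .
    qed
    then have "ennreal (h j) \<le> ennreal (C * exp (- real k)) * indicator (J k) j"
      using jk by (simp add: J_def ennreal_leI)
    also have "\<dots> \<le> ?S"
      using sum_le_suminf[of "\<lambda>k. ennreal (C * exp (- real k)) * indicator (J k) j" "{k}"]
      by (simp del: sum_mult_indicator)
    finally show ?thesis .
  qed (use h(1)[of j] in auto)
  have "(\<Sum>j. ennreal (h j)) = (\<integral>\<^sup>+ j. ennreal (h j) \<partial>count_space UNIV)"
    by (simp add: nn_integral_count_space_nat)
  also have "\<dots> \<le> (\<integral>\<^sup>+ j. (\<Sum>k. ennreal (C * exp (- real k)) * indicator (J k) j) \<partial>count_space UNIV)"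
    by (intro nn_integral_mono pw)
  also have "\<dots> = (\<Sum>k. ennreal (C * exp (- real k)) * emeasure (count_space UNIV) (J k))"
    by (subst nn_integral_suminf) (auto simp: nn_integral_cmult_indicator)
  also have "\<dots> \<le> (\<Sum>k. ennreal (C * Q * exp (- 1 / 2) ^ k))"
  proof (intro suminf_le allI)
    fix k
    have "ennreal (C * exp (- real k)) * emeasure (count_space UNIV) (J k) = ennreal (C * exp (- real k) * real (card (J k)))"
      using J(1)[of k] C unfolding J_def[symmetric] by (simp add: ennreal_mult' ennreal_of_nat_eq_real_of_nat)
    also have "C * exp (- real k) * real (card (J k)) \<le> C * exp (- real k) * (Q * exp (real k / 2))"
      unfolding J_def using J(2)[of k] C by (intro mult_left_mono) auto
    also have "\<dots> = C * Q * exp (- 1 / 2) ^ k"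
      by (simp add: exp_of_nat_mult[symmetric] mult_ac flip: exp_add)
    finally show "ennreal (C * exp (- real k)) * emeasure (count_space UNIV) (J k) \<le> ennreal (C * Q * exp (- 1 / 2) ^ k)"
      by (simp add: ennreal_leI)
  qed auto
  also have "\<dots> = ennreal (C * Q * (1 / (1 - exp (- 1 / 2))))"
    using C Q by (intro suminf_ennreal_eq sums_mult geometric_sums) auto
  finally show ?thesis by (simp add: C_def)
qed

lemma powr_le_exp_half:
  fixes x p :: real
  assumes "x \<ge> 0" "p > 0"
  shows "x powr p \<le> (2 * p) powr p * exp (x / 2)"
proof -
  have "x / (2 * p) \<le> exp (x / (2 * p))" using exp_ge_add_one_self[of "x / (2 * p)"] by linarith
  then have "(x / (2 * p)) powr p \<le> exp (x / (2 * p)) powr p"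
    using assms by (intro powr_mono2) auto
  also have "\<dots> = exp (x / 2)" using assms by (simp add: powr_def)
  finally show ?thesis using assms by (simp add: powr_divide field_simps)
qed

subsection \<open>The two-level estimate\<close>

text \<open>One radius \<open>R\<close> dominates the total mass, so that all effective radii of
  level sets are at most \<open>R\<close>; in \<open>exp_functional_le\<close> it also exceeds all
  distances in \<open>\<Omega>\<close>, so that truncating the kernel at \<open>R\<close> loses
  nothing.\<close>

locale frostman_measure =
  fixes M :: "'a::euclidean_space measure" and n d e p q w lam A R :: real
  assumes n: "n = real DIM('a)" and w: "w = sphere_area DIM('a)"
    and d_pos: "0 < d" and d_less: "d < n"
    and e_def: "e = n - d" and p_def: "p = n / d" and q_def: "q = n / e"
    and sets_M [measurable_cong]: "sets M = sets borel"
    and lam: "0 < lam" and A: "0 < A" and R: "0 < R"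
    and ball_le: "\<And>x r. 0 < r \<Longrightarrow> emeasure M (ball x r) \<le> ennreal (A * r powr lam)"
    and total_le: "emeasure M UNIV \<le> ennreal (R powr lam)"
begin

lemma space_M [simp]: "space M = UNIV"
  using sets_eq_imp_space_eq[OF sets_M] by simp

sublocale finite_measure M
proof
  show "emeasure M (space M) \<noteq> \<infinity>"
    using total_le by (auto simp: top_unique)
qed

lemma measure_le: "measure M E \<le> R powr lam"
proof -
  have "ennreal (measure M E) \<le> emeasure M UNIV"
    unfolding emeasure_eq_measure[symmetric] using emeasure_space[of M E] by simp
  then show ?thesis using total_le by (metis ennreal_le_iff order_trans powr_ge_zero)
qed

lemma average:
  assumes E: "E \<in> sets borel" and \<delta>: "0 < \<delta>" "measure M E = \<delta> powr lam"
  shows "frostman_average (uniform_measure M E) n d e p q w lam A \<delta>"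
proof
  have EM [measurable]: "E \<in> sets M" using E by (simp add: sets_M)
  have em: "emeasure M E = ennreal (\<delta> powr lam)" using \<delta> by (simp add: emeasure_eq_measure)
  show "sets (uniform_measure M E) = sets borel" by (simp add: sets_M)
  show "emeasure (uniform_measure M E) UNIV = 1"
    using \<delta> E by (subst emeasure_uniform_measure) (auto simp: sets_M em divide_ennreal)
  show "emeasure (uniform_measure M E) (ball x r) \<le> ennreal (A * (r / \<delta>) powr lam)" if "0 < r" for x r
  proof -
    have "emeasure (uniform_measure M E) (ball x r) = emeasure M (E \<inter> ball x r) / ennreal (\<delta> powr lam)"
      using E by (subst emeasure_uniform_measure) (auto simp: sets_M em)
    also have "\<dots> \<le> ennreal (A * r powr lam) / ennreal (\<delta> powr lam)"
      using that by (intro divide_right_mono_ennreal order_trans[OF emeasure_mono ball_le]) (auto simp: sets_M)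
    also have "\<dots> = ennreal (A * (r / \<delta>) powr lam)"
      using A \<delta> that by (simp add: divide_ennreal powr_divide)
    finally show ?thesis .
  qed
qed (use n w d_pos d_less e_def p_def q_def lam A \<delta> in auto)

lemma e_pos: "0 < e"
  using d_less by (simp add: e_def)

lemma pq: "p > 1" "q > 1" "1 / p + 1 / q = 1"
  using d_pos d_less by (auto simp: e_def p_def q_def field_simps)

lemma w_pos: "w > 0"
  unfolding w by (intro sphere_area_pos) auto

definition "c = w / lam"
text \<open>The constants of the averaging locales depend neither on the set nor on its effective
  radius, so they are uniform over level sets. Below, \<open>c5\<close> bounds the q-th power
  integral of the perturbation in \<open>two_level_bound\<close>, and \<open>G\<close> is the total
  additive error in units of \<open>c\<close>.\<close>

definition "c3 = radial_averages.C3 n e"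
definition "c4 = frostman_average.C4 n e p q lam A"
definition "c5 = 2 powr q * (c4 + 2 powr q * (c + c4))"
definition "G = q * 2 powr (q - 1) * (2 * c3 + c5) / c"

lemma c_pos: "c > 0"
  using w_pos lam by (simp add: c_def)

lemma budget_eq: "w * x + q * 2 powr (q - 1) * (2 * c3 + c5) = c * (lam * x + G)"
proof -
  have "c * lam = w" using lam by (simp add: c_def)
  moreover have "c * G = q * 2 powr (q - 1) * (2 * c3 + c5)" using c_pos by (simp add: G_def)
  ultimately show ?thesis by (metis distrib_left mult.assoc)
qed

text \<open>Positivity is obtained by interpreting the averaging locale, which takes an actual set
  of positive measure. This is why later constants, defined without such a set, contain the absolute
  value of \<open>G\<close>.\<close>

lemma c34_pos:
  assumes "E \<in> sets borel" and "0 < \<delta>" "measure M E = \<delta> powr lam"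
  shows "c3 > 0" "c4 > 0"
proof -
  interpret frostman_average "uniform_measure M E" n d e p q w lam A \<delta> using assms by (rule average)
  show "c3 > 0" "c4 > 0" using C3_pos C4_pos by (simp_all add: c3_def c4_def)
qed

lemma G_pos:
  assumes "E \<in> sets borel" and "0 < \<delta>" "measure M E = \<delta> powr lam"
  shows "G > 0"
proof -
  note c = c34_pos[OF assms] c_pos
  then have "c5 > 0" using pq by (simp add: c5_def add_pos_pos)
  then show ?thesis using c pq by (simp add: G_def add_pos_pos)
qed

end

locale frostman_potential = frostman_measure M n d e p q w lam A R
  for M :: "'a::euclidean_space measure" and n d e p q w lam A R +
  fixes f :: "'a \<Rightarrow> real"
  assumes f_meas [measurable]: "f \<in> borel_measurable borel"
    and f_nn: "\<And>y. 0 \<le> f y"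
    and f_norm: "(\<integral>\<^sup>+ y. ennreal (f y powr p) \<partial>lborel) \<le> 1"
begin

definition U :: "'a \<Rightarrow> ennreal" where
  "U x = (\<integral>\<^sup>+ y. ennreal (kern e 0 R (x - y) * f y) \<partial>lborel)"

lemma U_measurable [measurable]: "U \<in> borel_measurable borel"
  unfolding U_def[abs_def] by measurable

lemma AE_uniform:
  assumes "E \<in> sets borel" "\<And>x. x \<in> E \<Longrightarrow> ennreal s \<le> U x"
  shows "AE x in uniform_measure M E. ennreal s \<le> (\<integral>\<^sup>+ y. ennreal (kern e 0 R (x - y) * f y) \<partial>lborel)"
  using assms by (intro AE_uniform_measureI) (auto simp: sets_M U_def)

lemma \<delta>_le_R:
  assumes "0 < \<delta>" "measure M E = \<delta> powr lam"
  shows "\<delta> \<le> R"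
  using measure_le[of E] assms lam R by (metis less_eq_real_def not_le powr_less_mono2)

text \<open>The cut is made at the effective radius \<open>\<delta>\<close> itself, where the inner
  part is a bounded perturbation by \<open>H_inner\<close>.\<close>

lemma level_bound:
  assumes E: "E \<in> sets borel" and \<delta>: "0 < \<delta>" "measure M E = \<delta> powr lam"
    and level: "\<And>x. x \<in> E \<Longrightarrow> ennreal s \<le> U x"
  shows "s \<le> (c * (lam * ln (R / \<delta>) + G)) powr (1 / q)"
proof -
  interpret P: frostman_average "uniform_measure M E" n d e p q w lam A \<delta>
    using E \<delta> by (rule average)
  note c = c34_pos[OF E \<delta>] c_pos
  note \<delta>R = \<delta>_le_R[OF \<delta>]
  have "c5 > 0" using c pq by (simp add: c5_def add_pos_pos)
  have "ennreal s \<le> (\<integral>\<^sup>+ y. ennreal (f y * (P.H \<delta> R y + P.H 0 \<delta> y)) \<partial>lborel)"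
    using AE_uniform[OF E level] \<delta> \<delta>R by (intro P.level_le_dual_pairing f_nn f_meas)
  also have "\<dots> \<le> ennreal ((w * ln (R / \<delta>) + q * 2 powr (q - 1) * (c3 + c4)) powr (1 / q))"
    using c \<delta> \<delta>R P.H_ball_le[OF \<delta>(1)] P.H_inner
    by (intro P.dual_pairing_le f_nn f_norm f_meas) (auto simp: c3_def c4_def)
  finally have "s \<le> (w * ln (R / \<delta>) + q * 2 powr (q - 1) * (c3 + c4)) powr (1 / q)" by simp
  \<comment> \<open>Weakened to the error of \<open>two_level_bound\<close>, so that one constant
    \<open>G\<close> serves both estimates.\<close>
  also have "\<dots> \<le> (w * ln (R / \<delta>) + q * 2 powr (q - 1) * (2 * c3 + c5)) powr (1 / q)"
  proof (intro powr_mono2 add_left_mono mult_left_mono add_mono)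
    have "1 \<le> 2 powr q" using pq by (simp add: ge_one_powr_ge_zero)
    then have "1 * (c4 + 0) \<le> 2 powr q * (c4 + 2 powr q * (c + c4))" using c by (intro mult_mono add_mono) auto
    then show "c4 \<le> c5" by (simp add: c5_def)
    show "0 \<le> w * ln (R / \<delta>) + q * 2 powr (q - 1) * (c3 + c4)"
      using c \<delta> \<delta>R pq w_pos by (intro add_nonneg_nonneg mult_nonneg_nonneg) auto
  qed (use c pq in auto)
  finally show ?thesis unfolding budget_eq .
qed

text \<open>If \<open>f\<close> nearly saturates the bound at the level of \<open>E1\<close>, then it has little room left to
  raise the potential on the smaller set \<open>E2\<close>; the number \<open>I\<close> is the contribution to the average of
  the potential over \<open>E2\<close> of the points within distance \<open>\<delta>1\<close>.\<close>

lemma two_level_bound: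
  fixes \<delta>1 \<delta>2 :: real
  defines "D \<equiv> lam * ln (\<delta>1 / \<delta>2)"
    and "Y \<equiv> (c * (lam * ln (R / \<delta>1) + G)) powr (1 / q)"
  assumes E1: "E1 \<in> sets borel" and \<delta>1: "0 < \<delta>1" "measure M E1 = \<delta>1 powr lam"
    and E2: "E2 \<in> sets borel" and \<delta>2: "0 < \<delta>2" "measure M E2 = \<delta>2 powr lam"
    and s1: "s1 \<ge> 0" "\<And>x. x \<in> E1 \<Longrightarrow> ennreal s1 \<le> U x"
    and s2: "\<And>x. x \<in> E2 \<Longrightarrow> ennreal s2 \<le> U x"
    and D: "D \<ge> 1"
  obtains I where "I \<ge> 0" "s1 + D powr (- 1 / q) * I \<le> Y" "s2 \<le> Y + I"
proof -
  interpret P1: frostman_average "uniform_measure M E1" n d e p q w lam A \<delta>1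
    using E1 \<delta>1 by (rule average)
  interpret P2: frostman_average "uniform_measure M E2" n d e p q w lam A \<delta>2
    using E2 \<delta>2 by (rule average)
  note c = c34_pos[OF E1 \<delta>1] c_pos
  note \<delta>R = \<delta>_le_R[OF \<delta>1]
  have c5: "c5 > 0" using c pq by (simp add: c5_def add_pos_pos)
  have \<delta>12: "\<delta>2 \<le> \<delta>1"
  proof (rule ccontr)
    assume "\<not> \<delta>2 \<le> \<delta>1"
    then have "ln (\<delta>1 / \<delta>2) < 0" using \<delta>1 \<delta>2 by simp
    then show False using D lam unfolding D_def by (smt (verit) mult_pos_neg)
  qed
  \<comment> \<open>The q-th power integral of \<open>P2.H 0 \<delta>1\<close> grows linearly in
    \<open>D\<close>, so this weight keeps the q-th power of
    \<open>\<epsilon> * P2.H 0 \<delta>1\<close> bounded in integral.\<close>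
  define \<epsilon> where "\<epsilon> = D powr (- 1 / q)"
  have \<epsilon>: "0 < \<epsilon>" "\<epsilon> \<le> 1" "\<epsilon> powr q = 1 / D"
  proof -
    have "\<epsilon> powr q = D powr (- 1)" using pq unfolding \<epsilon>_def powr_powr by simp
    then show "\<epsilon> powr q = 1 / D" using D by (simp add: powr_minus_divide)
  qed (use D pq in \<open>auto simp: \<epsilon>_def powr_minus_divide ge_one_powr_ge_zero\<close>)
  \<comment> \<open>Adding a multiple of the inner kernel of \<open>E2\<close> to that of
    \<open>E1\<close> stays within the budget \<open>Y\<close>; therefore what \<open>f\<close>
    already spends on \<open>s1\<close> limits its pairing with the inner kernel of
    \<open>E2\<close>.\<close>
  define X where "X y = P1.H 0 \<delta>1 y + \<epsilon> * P2.H 0 \<delta>1 y" for y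
  have X0: "X y \<ge> 0" for y using \<epsilon> by (simp add: X_def)
  have Xm [measurable]: "X \<in> borel_measurable borel" unfolding X_def[abs_def] by measurable
  have "(\<integral>\<^sup>+ y. ennreal (X y) \<partial>lborel) = (\<integral>\<^sup>+ y. ennreal (P1.H 0 \<delta>1 y) \<partial>lborel) + ennreal \<epsilon> * (\<integral>\<^sup>+ y. ennreal (P2.H 0 \<delta>1 y) \<partial>lborel)"
    using \<epsilon> by (simp add: X_def nn_integral_add nn_integral_cmult ennreal_mult')
  also have "\<dots> \<le> ennreal (c3 * \<delta>1 powr d) + ennreal 1 * ennreal (c3 * \<delta>1 powr d)"
    unfolding c3_def using \<epsilon> by (intro add_mono mult_mono P1.H_ball_le P2.H_ball_le \<delta>1 ennreal_leI) auto
  also have "\<dots> = ennreal (2 * c3 * \<delta>1 powr d)"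
    using c by (simp flip: ennreal_plus)
  finally have X1: "(\<integral>\<^sup>+ y. ennreal (X y) \<partial>lborel) \<le> ennreal (2 * c3 * \<delta>1 powr d)" .
  have "X y powr q \<le> 2 powr q * (P1.H 0 \<delta>1 y powr q + 1 / D * P2.H 0 \<delta>1 y powr q)" for y
    using powr_add_le_double[of "P1.H 0 \<delta>1 y" "\<epsilon> * P2.H 0 \<delta>1 y" q] \<epsilon> pq
    by (simp add: X_def powr_mult)
  then have "(\<integral>\<^sup>+ y. ennreal (X y powr q) \<partial>lborel) \<le>
     (\<integral>\<^sup>+ y. ennreal (2 powr q) * (ennreal (P1.H 0 \<delta>1 y powr q) + ennreal (1 / D) * ennreal (P2.H 0 \<delta>1 y powr q)) \<partial>lborel)"
    using D by (intro nn_integral_mono) (simp flip: ennreal_mult' ennreal_plus)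
  also have "\<dots> = ennreal (2 powr q) * ((\<integral>\<^sup>+ y. ennreal (P1.H 0 \<delta>1 y powr q) \<partial>lborel)
      + ennreal (1 / D) * (\<integral>\<^sup>+ y. ennreal (P2.H 0 \<delta>1 y powr q) \<partial>lborel))"
    by (simp add: nn_integral_add nn_integral_cmult)
  also have "\<dots> \<le> ennreal (2 powr q) * (ennreal c4 + ennreal (1 / D) * ennreal (2 powr q * (w * ln (\<delta>1 / \<delta>2) + c4)))"
    unfolding c4_def by (intro mult_left_mono add_mono P1.H_inner P2.H_ball_powr_le \<delta>12) auto
  also have "\<dots> = ennreal (2 powr q * (c4 + 1 / D * (2 powr q * (c * D + c4))))"
  proof -
    have "w * ln (\<delta>1 / \<delta>2) = c * D" using lam by (simp add: c_def D_def)
    moreover have "c * D + c4 \<ge> 0" using c D by simp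
    ultimately show ?thesis using c D by (simp flip: ennreal_mult' ennreal_plus)
  qed
  also have "\<dots> \<le> ennreal c5"
  proof (rule ennreal_leI)
    have "1 / D * (2 powr q * (c * D + c4)) = 2 powr q * (c + c4 / D)" using D by (simp add: field_simps)
    also have "\<dots> \<le> 2 powr q * (c + c4)" using D c by (simp add: divide_le_eq)
    finally show "2 powr q * (c4 + 1 / D * (2 powr q * (c * D + c4))) \<le> c5" by (simp add: c5_def)
  qed
  finally have X2: "(\<integral>\<^sup>+ y. ennreal (X y powr q) \<partial>lborel) \<le> ennreal c5" .
  have Y: "Y = (w * ln (R / \<delta>1) + q * 2 powr (q - 1) * (2 * c3 + c5)) powr (1 / q)"
    unfolding Y_def budget_eq ..
  define J where "J = (\<integral>\<^sup>+ y. ennreal (f y * P2.H 0 \<delta>1 y) \<partial>lborel)"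
  have "ennreal s1 + ennreal \<epsilon> * J
    \<le> (\<integral>\<^sup>+ y. ennreal (f y * (P1.H \<delta>1 R y + P1.H 0 \<delta>1 y)) \<partial>lborel) + ennreal \<epsilon> * J"
    using AE_uniform[OF E1 s1(2)] \<delta>1 \<delta>R by (intro add_right_mono P1.level_le_dual_pairing f_nn f_meas)
  also have "\<dots> = (\<integral>\<^sup>+ y. ennreal (f y * (P1.H \<delta>1 R y + X y)) \<partial>lborel)"
    unfolding J_def X_def using f_nn \<epsilon>
    by (simp add: nn_integral_cmult[symmetric] nn_integral_add[symmetric] algebra_simps flip: ennreal_mult' ennreal_plus)
  also have "\<dots> \<le> ennreal Y"
    unfolding Y using c c5 \<delta>1 \<delta>R X1 X2 by (intro P1.dual_pairing_le f_nn f_norm f_meas Xm X0) auto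
  finally have 1: "ennreal s1 + ennreal \<epsilon> * J \<le> ennreal Y" .
  have "J \<noteq> top"
  proof
    assume "J = top"
    with 1 \<epsilon> show False by (simp add: ennreal_mult_top top_unique)
  qed
  then obtain I where I: "J = ennreal I" "I \<ge> 0" by (cases J) auto
  have 1: "s1 + \<epsilon> * I \<le> Y"
    using 1 s1(1) \<epsilon> I by (simp add: Y_def flip: ennreal_mult' ennreal_plus)
  \<comment> \<open>The outer kernel of \<open>E2\<close>, cut at \<open>\<delta>1\<close>, obeys
    the same annulus bound as that of \<open>E1\<close>; anything of \<open>s2\<close> beyond
    \<open>Y\<close> must come from \<open>J\<close>.\<close>
  have "ennreal s2 \<le> (\<integral>\<^sup>+ y. ennreal (f y * (P2.H \<delta>1 R y + P2.H 0 \<delta>1 y)) \<partial>lborel)"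
    using AE_uniform[OF E2 s2] \<delta>1 \<delta>R by (intro P2.level_le_dual_pairing f_nn f_meas)
  also have "\<dots> = (\<integral>\<^sup>+ y. ennreal (f y * (P2.H \<delta>1 R y + 0)) \<partial>lborel) + J"
    unfolding J_def using f_nn
    by (simp add: nn_integral_add[symmetric] algebra_simps flip: ennreal_mult' ennreal_plus)
  also have "\<dots> \<le> ennreal Y + ennreal I"
    unfolding Y I using c c5 \<delta>1 \<delta>R
    by (intro add_right_mono P2.dual_pairing_le f_nn f_norm f_meas) auto
  finally have "ennreal s2 \<le> ennreal Y + ennreal I" .
  moreover have "Y \<ge> 0" by (simp add: Y_def)
  ultimately have "s2 \<le> Y + I"
    using I by (metis add_nonneg_nonneg ennreal_le_iff ennreal_plus)
  with 1 I that show ?thesis by (auto simp: \<epsilon>_def)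
qed

end

subsection \<open>Summation over the level sets\<close>

lemma finite_card_nat_interval:
  fixes l N :: real
  assumes "N \<ge> 0"
  shows "finite {j::nat. l \<le> j \<and> j < l + N}" "real (card {j::nat. l \<le> j \<and> j < l + N}) \<le> N + 1"
proof -
  let ?S = "{j::nat. l \<le> j \<and> j < l + N}"
  have sub: "int ` ?S \<subseteq> {\<lceil>l\<rceil>..<\<lceil>l\<rceil> + \<lceil>N\<rceil>}"
  proof
    fix i assume "i \<in> int ` ?S"
    then have "l \<le> real_of_int i" "real_of_int i < l + N" by auto
    then show "i \<in> {\<lceil>l\<rceil>..<\<lceil>l\<rceil> + \<lceil>N\<rceil>}" by (simp; linarith)
  qed
  then have "finite (int ` ?S)" by (rule finite_subset) simp
  then show "finite ?S" by (rule finite_imageD) simp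
  have "card ?S = card (int ` ?S)" by (subst card_image) auto
  also have "\<dots> \<le> card {\<lceil>l\<rceil>..<\<lceil>l\<rceil> + \<lceil>N\<rceil>}" by (intro card_mono sub) simp
  finally show "real (card ?S) \<le> N + 1" using assms by simp linarith
qed

context frostman_measure
begin

text \<open>If level \<open>i\<close> is saturated up to \<open>exp (- k)\<close>, then
  \<open>a = t i - L - k\<close> is at most \<open>i\<close> and \<open>t i + G\<close> is at most
  \<open>a + gap k\<close>. Thus \<open>gap k\<close> is the \<open>m\<close> of
  \<open>two_level_real\<close> and \<open>Mk k\<close> its conclusion, polynomial in
  \<open>k\<close>.\<close>

definition "L = \<bar>lam * ln R\<bar>"
definition "gap k = \<bar>G\<bar> + 1 + L + real k" for k :: nat
definition "Mk k = 2 * (2 * q * gap k) powr p" for k :: nat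
definition "Q = 2 * (3 + 4 * exp (gap 0 / 2) + 2 * (2 * q) powr p * ((2 * p) powr p * exp (gap 0 / 2)))"
definition "S = max (exp 1) (R powr lam * exp \<bar>G\<bar>) * Q / (1 - exp (- 1 / 2))"

lemma gap_pos: "gap k > 0"
  unfolding gap_def L_def by linarith

lemma Q_nonneg: "Q \<ge> 0"
  using pq by (simp add: Q_def)

text \<open>The left side is the count in \<open>card_superlevel\<close>: two windows with at most
  \<open>N + 1\<close> integers each. Being polynomial in \<open>k\<close>, it is absorbed by
  \<open>exp (k / 2)\<close>.\<close>

lemma Mk_bound: "2 * (2 + Mk k + gap k + \<bar>G\<bar>) + 2 \<le> Q * exp (real k / 2)"
proof -
  have ex: "exp (gap k / 2) = exp (gap 0 / 2) * exp (real k / 2)"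
    by (simp add: gap_def add_divide_distrib flip: exp_add)
  have "gap k / 2 \<le> exp (gap k / 2)" using exp_ge_add_one_self[of "gap k / 2"] by linarith
  then have 1: "gap k \<le> 2 * exp (gap 0 / 2) * exp (real k / 2)" by (simp add: ex)
  have 2: "\<bar>G\<bar> \<le> gap k" by (simp add: gap_def L_def)
  have "gap k powr p \<le> (2 * p) powr p * (exp (gap 0 / 2) * exp (real k / 2))"
    using powr_le_exp_half[of "gap k" p] gap_pos[of k] pq by (simp add: ex)
  then have "2 * (2 * q) powr p * gap k powr p \<le> 2 * (2 * q) powr p * ((2 * p) powr p * (exp (gap 0 / 2) * exp (real k / 2)))"
    by (intro mult_left_mono) auto
  then have 3: "Mk k \<le> 2 * (2 * q) powr p * ((2 * p) powr p * exp (gap 0 / 2)) * exp (real k / 2)"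
    using pq gap_pos[of k] by (simp add: Mk_def powr_mult mult_ac)
  define X where "X = exp (real k / 2)"
  have "1 \<le> X" by (simp add: X_def)
  with 1 2 3 show ?thesis unfolding Q_def X_def[symmetric] by (simp add: algebra_simps)
qed

end

context frostman_potential
begin

text \<open>Unit steps of the exponent \<open>1 / c * u powr q\<close>, where \<open>u\<close> is
  the value of the potential.\<close>

definition E :: "nat \<Rightarrow> 'a set" where
  "E j = {x. ennreal ((c * real j) powr (1 / q)) \<le> U x}"

lemma E_borel [measurable]: "E j \<in> sets borel"
  unfolding E_def by measurable

text \<open>For sets of positive measure this is \<open>lam * ln R - ln (measure M (E j))\<close>,
  the logarithmic quantity to be compared with \<open>j\<close>.\<close>

definition t :: "nat \<Rightarrow> real" where
  "t j = lam * ln (R / measure M (E j) powr (1 / lam))"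

lemma E_radius:
  assumes "measure M (E j) > 0"
  shows "0 < measure M (E j) powr (1 / lam)" "measure M (E j) = (measure M (E j) powr (1 / lam)) powr lam"
  using assms lam by (auto simp: powr_powr)

lemma t_eq:
  assumes "measure M (E j) > 0"
  shows "t j = lam * ln R - ln (measure M (E j))"
  unfolding t_def using assms R lam by (simp add: ln_div ln_powr algebra_simps)

lemma G_pos_of_level:
  assumes "measure M (E j) > 0"
  shows "G > 0"
  using G_pos[OF E_borel E_radius[OF assms]] .

lemma t_nonneg:
  assumes "measure M (E j) > 0"
  shows "t j \<ge> 0"
  unfolding t_def using \<delta>_le_R[OF E_radius[OF assms]] E_radius(1)[OF assms] lam
  by (intro mult_nonneg_nonneg ln_ge_zero) (auto simp: le_divide_eq)

text \<open>The level estimate with q-th powers taken. It makes \<open>h\<close> bounded but does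
  not yet make it summable.\<close>

lemma weak_bound:
  assumes "measure M (E j) > 0"
  shows "real j \<le> t j + G"
proof (rule ccontr)
  assume less: "\<not> real j \<le> t j + G"
  have "(c * real j) powr (1 / q) \<le> (c * (t j + G)) powr (1 / q)"
    using level_bound[OF E_borel E_radius[OF assms], of "(c * real j) powr (1 / q)"]
    unfolding t_def by (auto simp: E_def)
  moreover have "(c * (t j + G)) powr (1 / q) < (c * real j) powr (1 / q)"
    using less G_pos_of_level[OF assms] t_nonneg[OF assms] c_pos pq by (intro powr_less_mono2) auto
  ultimately show False by simp
qed

definition h :: "nat \<Rightarrow> real" where "h j = exp (real j) * measure M (E j)"

lemma h_le: "h j \<le> R powr lam * exp \<bar>G\<bar>"
proof (cases "measure M (E j) > 0")
  case True
  then have "ln (measure M (E j)) \<le> lam * ln R + \<bar>G\<bar> - real j"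
    using weak_bound[OF True] t_eq[OF True] by linarith
  then have "exp (ln (measure M (E j))) \<le> exp (lam * ln R + \<bar>G\<bar> - real j)"
    unfolding exp_le_cancel_iff .
  then have "measure M (E j) \<le> R powr lam * exp \<bar>G\<bar> / exp (real j)"
    using True R by (simp add: powr_def exp_add exp_diff)
  then show ?thesis by (simp add: h_def field_simps)
next
  case False
  then have "measure M (E j) = 0" using measure_nonneg[of M "E j"] by linarith
  then show ?thesis by (simp add: h_def)
qed

text \<open>The converse of \<open>weak_bound\<close> up to an error \<open>L + k\<close>: on
  saturated levels \<open>j\<close> and \<open>t j\<close> determine each other up to
  \<open>gap k\<close>.\<close>

lemma superlevel:
  assumes "exp (- real k) \<le> h j"
  shows "measure M (E j) > 0" "t j - L - real k \<le> real j"
proof -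
  have "h j > 0" using assms exp_gt_zero[of "- real k"] by linarith
  then show pos: "measure M (E j) > 0" by (simp add: h_def zero_less_mult_iff)
  have "ln (exp (- real k)) \<le> ln (h j)" using assms \<open>h j > 0\<close> by (subst ln_le_cancel_iff) auto
  then have "- real k \<le> real j + ln (measure M (E j))" using pos by (simp add: h_def ln_mult)
  then show "t j - L - real k \<le> real j"
    using t_eq[OF pos] by (simp add: L_def)
qed

text \<open>\<open>two_level_bound\<close> for \<open>E i\<close> and \<open>E j\<close> supplies
  exactly the hypotheses of \<open>two_level_real\<close> with \<open>D = t j - t i\<close>. The
  summand 1 ensures \<open>D \<ge> 1\<close> in the argument by contradiction.\<close>

lemma superlevel_gap:
  assumes i: "exp (- real k) \<le> h i" and j: "exp (- real k) \<le> h j"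
    and large: "t i - L - real k \<ge> Mk k"
  shows "t j - t i \<le> 1 + Mk k"
proof (rule ccontr)
  assume "\<not> t j - t i \<le> 1 + Mk k"
  then have D: "t j - t i > 1 + Mk k" by simp
  have Mk: "Mk k > 0" using pq gap_pos[of k] by (simp add: Mk_def)
  note i = superlevel[OF i] and j = superlevel[OF j]
  define a where "a = t i - L - real k"
  let ?\<delta> = "\<lambda>j. measure M (E j) powr (1 / lam)"
  have tt: "lam * ln (?\<delta> i / ?\<delta> j) = t j - t i"
    using i j R lam by (simp add: t_def ln_div algebra_simps)
  have lvl: "ennreal ((c * real j) powr (1 / q)) \<le> U x" if "x \<in> E j" for x j using that by (simp add: E_def)
  obtain I where I: "I \<ge> 0"
    "(c * real i) powr (1 / q) + (t j - t i) powr (- 1 / q) * I \<le> (c * (t i + G)) powr (1 / q)"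
    "(c * real j) powr (1 / q) \<le> (c * (t i + G)) powr (1 / q) + I"
    by (rule two_level_bound[OF E_borel E_radius[OF i(1)] E_borel E_radius[OF j(1)], unfolded tt,
          OF powr_ge_zero lvl lvl, folded t_def]) (use D Mk in auto)
  have a: "a \<ge> Mk k" using large by (simp add: a_def)
  have mono: "(c * x) powr (1 / q) \<le> (c * y) powr (1 / q)" if "0 \<le> x" "x \<le> y" for x y
    using that c_pos pq by (intro powr_mono2) auto
  have up: "(c * (t i + G)) powr (1 / q) \<le> (c * (a + gap k)) powr (1 / q)"
    using t_nonneg[OF i(1)] G_pos_of_level[OF i(1)] by (intro mono) (auto simp: a_def gap_def)
  have "t j - t i \<le> 2 * (2 * q * gap k) powr p"
  proof (rule two_level_real[OF pq c_pos _ _ gap_pos I(1)])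
    have "(c * a) powr (1 / q) \<le> (c * real i) powr (1 / q)"
      using i(2) a Mk by (intro mono) (auto simp: a_def)
    then show "(c * a) powr (1 / q) + (t j - t i) powr (- 1 / q) * I \<le> (c * (a + gap k)) powr (1 / q)"
      using I(2) up by linarith
    have "(c * (a + (t j - t i))) powr (1 / q) \<le> (c * real j) powr (1 / q)"
      using j(2) a Mk D by (intro mono) (auto simp: a_def)
    then show "(c * (a + (t j - t i))) powr (1 / q) \<le> (c * (a + gap k)) powr (1 / q) + I"
      using I(3) up by linarith
    show "2 * (2 * q * gap k) powr p \<le> a" using a by (simp add: Mk_def)
  qed (use D Mk a in auto)
  with D show False by (simp add: Mk_def)
qed

text \<open>Saturated indices with small \<open>t j\<close> lie in a window starting at 0 by
  \<open>weak_bound\<close>. The others lie in a window starting at the least of them, because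
  \<open>superlevel_gap\<close> keeps their \<open>t j\<close> close to that of the least
  one.\<close>

lemma card_superlevel:
  "finite {j. exp (- real k) \<le> h j} \<and> real (card {j. exp (- real k) \<le> h j}) \<le> Q * exp (real k / 2)"
proof -
  define N where "N = 2 + Mk k + gap k + \<bar>G\<bar>"
  have Mk: "Mk k \<ge> 0" using gap_pos[of k] by (simp add: Mk_def)
  have N: "N \<ge> 0" using Mk gap_pos[of k] by (simp add: N_def)
  define I where "I l = {j::nat. l \<le> real j \<and> real j < l + N}" for l
  define J where "J = {j. exp (- real k) \<le> h j \<and> t j - L - real k \<ge> Mk k}"
  \<comment> \<open>If \<open>J\<close> is empty, \<open>j0\<close> is arbitrary and its window
    merely adds indices to the count.\<close>
  define j0 where "j0 = (LEAST j. j \<in> J)"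
  have "{j. exp (- real k) \<le> h j} \<subseteq> I 0 \<union> I (real j0)"
  proof
    fix j assume "j \<in> {j. exp (- real k) \<le> h j}"
    then have hj: "exp (- real k) \<le> h j" by simp
    note j = superlevel[OF hj] weak_bound[OF superlevel(1)[OF hj]]
    show "j \<in> I 0 \<union> I (real j0)"
    proof (cases "j \<in> J")
      case True
      then have "j0 \<in> J" "j0 \<le> j" unfolding j0_def by (rule LeastI, rule Least_le)
      then have j0: "exp (- real k) \<le> h j0" "t j0 - L - real k \<ge> Mk k" by (auto simp: J_def)
      show ?thesis
        using superlevel_gap[OF j0(1) hj j0(2)] superlevel(2)[OF j0(1)] j \<open>j0 \<le> j\<close>
        by (auto simp: I_def N_def gap_def)
    next
      case False
      then show ?thesis using hj j by (auto simp: J_def I_def N_def gap_def)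
    qed
  qed
  moreover have "finite (I l)" "real (card (I l)) \<le> N + 1" for l
    using finite_card_nat_interval[OF N, of l] by (simp_all add: I_def)
  ultimately have fin: "finite {j. exp (- real k) \<le> h j}"
    and "real (card {j. exp (- real k) \<le> h j}) \<le> real (card (I 0 \<union> I (real j0)))"
    by (auto intro: finite_subset card_mono)
  moreover have "real (card (I 0 \<union> I (real j0))) \<le> real (card (I 0)) + real (card (I (real j0)))"
    using card_Un_le[of "I 0" "I (real j0)"] by linarith
  ultimately have "real (card {j. exp (- real k) \<le> h j}) \<le> 2 * N + 2"
    using \<open>\<And>l. real (card (I l)) \<le> N + 1\<close>[of 0] \<open>\<And>l. real (card (I l)) \<le> N + 1\<close>[of "real j0"] by linarith
  then show ?thesis using fin Mk_bound[of k] by (simp add: N_def)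
qed

lemma sum_h_le: "(\<Sum>j. ennreal (h j)) \<le> ennreal S"
  unfolding S_def using card_superlevel h_le Q_nonneg
  by (intro suminf_le_of_superlevel_card) (auto simp: h_def)

text \<open>The separate infinite case follows the convention of \<open>exp_functional\<close>;
  \<open>enn2real\<close> alone would give the value 1 there.\<close>

definition \<Phi> :: "ennreal \<Rightarrow> ennreal" where
  "\<Phi> u = (if u = \<infinity> then \<infinity> else ennreal (exp (1 / c * enn2real u powr q)))"

text \<open>If \<open>U x\<close> is finite, the single term with \<open>j\<close> the integer part
  of the exponent suffices, \<open>j + 1\<close> making up for rounding. If it is infinite,
  \<open>x\<close> lies in every \<open>E j\<close> and the terms are unbounded.\<close>

lemma \<Phi>_le: "\<Phi> (U x) \<le> (\<Sum>j. ennreal (exp (real j + 1)) * indicator (E j) x)" (is "_ \<le> ?S")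
proof -
  have term_le: "ennreal (exp (real j + 1)) \<le> ?S" if "x \<in> E j" for j
    using sum_le_suminf[of "\<lambda>j. ennreal (exp (real j + 1)) * indicator (E j) x" "{j}"] that
    by (simp del: sum_mult_indicator)
  show ?thesis
  proof (cases "U x")
    case top
    have "?S = top"
    proof (rule ccontr)
      assume "?S \<noteq> top"
      then obtain B where B: "?S = ennreal B" "B \<ge> 0" by (cases ?S) auto
      obtain j :: nat where "B < real j" using reals_Archimedean2 by blast
      moreover have "real j + 1 \<le> exp (real j + 1)" using exp_ge_add_one_self[of "real j + 1"] by linarith
      moreover have "exp (real j + 1) \<le> B"
      proof -
        have "x \<in> E j" using top by (simp add: E_def)
        then have "ennreal (exp (real j + 1)) \<le> ennreal B" unfolding B(1)[symmetric] by (rule term_le)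
        then show ?thesis using B(2) by simp
      qed
      ultimately show False by linarith
    qed
    then show ?thesis by simp
  next
    case (real r)
    define u where "u = 1 / c * r powr q"
    have u: "u \<ge> 0" using c_pos by (simp add: u_def)
    define j where "j = nat \<lfloor>u\<rfloor>"
    have j: "real j \<le> u" "u \<le> real j + 1" using u unfolding j_def by linarith+
    have "c * real j \<le> r powr q" using j(1) c_pos by (simp add: u_def field_simps)
    then have "(c * real j) powr (1 / q) \<le> (r powr q) powr (1 / q)"
      using c_pos pq by (intro powr_mono2) auto
    also have "\<dots> = r" using real pq by (simp add: powr_powr)
    finally have "x \<in> E j" using real by (simp add: E_def ennreal_leI)
    then have jS: "ennreal (exp (real j + 1)) \<le> ?S" by (rule term_le)
    have \<Phi>u: "\<Phi> (U x) = ennreal (exp u)" using real by (simp add: \<Phi>_def u_def)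
    have "ennreal (exp u) \<le> ennreal (exp (real j + 1))" using j by (intro ennreal_leI) simp
    from this jS show ?thesis unfolding \<Phi>u by (rule order_trans)
  qed
qed

lemma exp_integral_le: "(\<integral>\<^sup>+ x. \<Phi> (U x) \<partial>M) \<le> ennreal (exp 1 * S)"
proof -
  have "(\<integral>\<^sup>+ x. \<Phi> (U x) \<partial>M) \<le> (\<integral>\<^sup>+ x. (\<Sum>j. ennreal (exp (real j + 1)) * indicator (E j) x) \<partial>M)"
    by (intro nn_integral_mono \<Phi>_le)
  also have "\<dots> = (\<Sum>j. ennreal (exp (real j + 1)) * emeasure M (E j))"
    by (subst nn_integral_suminf) (auto simp: nn_integral_cmult_indicator sets_M)
  also have "\<dots> = (\<Sum>j. ennreal (exp 1) * ennreal (h j))"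
    by (simp add: emeasure_eq_measure h_def exp_add mult_ac flip: ennreal_mult')
  also have "\<dots> = ennreal (exp 1) * (\<Sum>j. ennreal (h j))"
    by (rule ennreal_suminf_cmult)
  also have "\<dots> \<le> ennreal (exp 1) * ennreal S"
    by (intro mult_left_mono sum_h_le) auto
  finally show ?thesis by (simp add: ennreal_mult')
qed

end

section \<open>Transfer to kernels dominated by the Riesz kernel\<close>

lemma (in frostman_measure) exp_functional_le:
  fixes g :: "'a \<Rightarrow> 'b::euclidean_space" and k :: "'a \<Rightarrow> 'a \<Rightarrow> real"
  assumes M: "M = density \<nu> (indicator \<Omega>)" and \<nu>: "sets \<nu> = sets borel" and \<Omega>: "\<Omega> \<in> sets borel"
    and diam: "\<And>x y. x \<in> \<Omega> \<Longrightarrow> y \<in> \<Omega> \<Longrightarrow> norm (x - y) < R"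
    and g: "g \<in> Lp_on \<Omega> p"
    and k_meas: "\<And>x. set_borel_measurable lebesgue \<Omega> (k x)"
    and k_le: "\<And>x y. \<bar>k x y\<bar> \<le> norm (x - y) powr (- e) * norm (g y)"
  shows "exp_functional \<nu> \<Omega> (lam / w) q k (Lp_norm_on \<Omega> p g) \<le> ennreal (exp 1 * S)"
proof -
  define N where "N = Lp_norm_on \<Omega> p g"
  define v where "v y = norm (indicator \<Omega> y *\<^sub>R g y)" for y
  have gm: "(\<lambda>y. indicator \<Omega> y *\<^sub>R g y) \<in> borel_measurable lebesgue"
    using g by (simp add: Lp_on_def set_borel_measurable_def)
  then have v_lebesgue: "v \<in> borel_measurable lebesgue" unfolding v_def[abs_def] by measurable
  obtain v' where vm [measurable]: "v' \<in> borel_measurable lborel" and vv': "AE y in lborel. v y = v' y"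
    using completion_ex_borel_measurable_real[OF v_lebesgue] by blast
  have Ieq: "(\<integral>\<^sup>+ y\<in>\<Omega>. ennreal (norm (g y) powr p) \<partial>lebesgue) = (\<integral>\<^sup>+ y. ennreal (v' y powr p) \<partial>lborel)"
  proof -
    have "(\<integral>\<^sup>+ y\<in>\<Omega>. ennreal (norm (g y) powr p) \<partial>lebesgue) = (\<integral>\<^sup>+ y. ennreal (v y powr p) \<partial>lebesgue)"
      by (intro nn_integral_cong) (auto simp: v_def indicator_def)
    also have "\<dots> = (\<integral>\<^sup>+ y. ennreal (v y powr p) \<partial>lborel)"
      by (rule nn_integral_completion)
    also have "\<dots> = (\<integral>\<^sup>+ y. ennreal (v' y powr p) \<partial>lborel)"
      by (rule nn_integral_cong_AE) (use vv' in eventually_elim, simp)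
    finally show ?thesis .
  qed
  then have "(\<integral>\<^sup>+ y. ennreal (v' y powr p) \<partial>lborel) < \<infinity>"
    using g by (simp add: Lp_on_def)
  then obtain I where I: "(\<integral>\<^sup>+ y. ennreal (v' y powr p) \<partial>lborel) = ennreal I" "I \<ge> 0"
    by (cases "\<integral>\<^sup>+ y. ennreal (v' y powr p) \<partial>lborel") auto
  have N: "N = I powr (1 / p)" unfolding N_def Lp_norm_on_def Ieq I(1) using I(2) by simp
  \<comment> \<open>A Borel representative, normalised. If \<open>N = 0\<close>, division by zero
    makes \<open>f\<close> vanish, and \<open>v y = N * f y\<close> still holds almost everywhere
    because \<open>v\<close> is then null.\<close>
  define f where "f y = \<bar>v' y\<bar> / N" for y
  have vf: "AE y in lborel. v y = N * f y"
  proof (cases "I = 0")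
    case False
    then have "N \<noteq> 0" using I by (simp add: N)
    show ?thesis using vv'
    proof eventually_elim
      case (elim y)
      have "v y \<ge> 0" by (simp add: v_def)
      then show ?case using elim \<open>N \<noteq> 0\<close> by (simp add: f_def)
    qed
  next
    case True
    then have "AE y in lborel. ennreal (v' y powr p) = 0"
      using I by (subst nn_integral_0_iff_AE[symmetric]) auto
    then show ?thesis using vv'
    proof eventually_elim
      case (elim y)
      then have "v' y = 0" using powr_gt_zero[of "v' y" p] by (simp add: ennreal_eq_0_iff)
      then show ?case using elim True by (simp add: N)
    qed
  qed
  interpret frostman_potential M n d e p q w lam A R f
  proof
    show "f \<in> borel_measurable borel" unfolding f_def[abs_def] by measurable
    show "0 \<le> f y" for y by (simp add: f_def N)
    show "(\<integral>\<^sup>+ y. ennreal (f y powr p) \<partial>lborel) \<le> 1"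
    proof (cases "I = 0")
      case True
      then show ?thesis by (simp add: f_def N)
    next
      case False
      have "(\<integral>\<^sup>+ y. ennreal (f y powr p) \<partial>lborel) = (\<integral>\<^sup>+ y. ennreal (1 / I) * ennreal (v' y powr p) \<partial>lborel)"
      proof (rule nn_integral_cong_AE)
        show "AE y in lborel. ennreal (f y powr p) = ennreal (1 / I) * ennreal (v' y powr p)"
          using vv'
        proof eventually_elim
          case (elim y)
          have "v' y \<ge> 0" unfolding elim[symmetric] by (simp add: v_def)
          then have "f y powr p = 1 / I * v' y powr p"
            using pq I False by (simp add: f_def N powr_divide powr_powr)
          then show ?case using I by (simp add: ennreal_mult'[symmetric])
        qed
      qed
      also have "\<dots> = ennreal (1 / I) * ennreal I" by (simp add: nn_integral_cmult I)
      also have "\<dots> = 1" using I False by (simp flip: ennreal_mult')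
      finally show ?thesis by simp
    qed
  qed
  have N0: "N \<ge> 0" by (simp add: N)
  \<comment> \<open>A finite \<open>U x\<close> forces absolute convergence of the potential, so the
    infinite branch occurs only where the right side is infinite too.\<close>
  have pw: "(if set_integrable lebesgue \<Omega> (k x)
      then ennreal (exp (lam / w * (\<bar>LINT y:\<Omega>|lebesgue. k x y\<bar> / N) powr q)) else \<infinity>) \<le> \<Phi> (U x)"
    if x: "x \<in> \<Omega>" for x
  proof (cases "U x")
    case top
    then show ?thesis by (simp add: \<Phi>_def)
  next
    case (real r)
    have km: "(\<lambda>y. indicator \<Omega> y *\<^sub>R k x y) \<in> borel_measurable lebesgue"
      using k_meas[of x] by (simp add: set_borel_measurable_def)
    have "(\<integral>\<^sup>+ y. ennreal (norm (indicator \<Omega> y *\<^sub>R k x y)) \<partial>lebesgue)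
        = (\<integral>\<^sup>+ y. ennreal (norm (indicator \<Omega> y *\<^sub>R k x y)) \<partial>lborel)"
      by (rule nn_integral_completion)
    also have "\<dots> \<le> (\<integral>\<^sup>+ y. ennreal N * ennreal (kern e 0 R (x - y) * f y) \<partial>lborel)"
    proof (rule nn_integral_mono_AE)
      show "AE y in lborel. ennreal (norm (indicator \<Omega> y *\<^sub>R k x y)) \<le> ennreal N * ennreal (kern e 0 R (x - y) * f y)"
        using vf
      proof eventually_elim
        case (elim y)
        have "norm (indicator \<Omega> y *\<^sub>R k x y) \<le> kern e 0 R (x - y) * v y"
          using k_le[of x y] diam[OF x, of y] by (auto simp: indicator_def kern_def v_def)
        also have "\<dots> = N * (kern e 0 R (x - y) * f y)" by (simp add: elim)
        finally show ?case using N0 by (simp add: ennreal_leI flip: ennreal_mult')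
      qed
    qed
    also have "\<dots> = ennreal N * U x" by (simp add: nn_integral_cmult U_def)
    also have "\<dots> = ennreal (N * r)" using real N0 by (simp flip: ennreal_mult')
    finally have le: "(\<integral>\<^sup>+ y. ennreal (norm (indicator \<Omega> y *\<^sub>R k x y)) \<partial>lebesgue) \<le> ennreal (N * r)" .
    then have int: "integrable lebesgue (\<lambda>y. indicator \<Omega> y *\<^sub>R k x y)"
      using km by (intro integrableI_bounded) (auto intro: le_less_trans)
    have "ennreal \<bar>LINT y:\<Omega>|lebesgue. k x y\<bar> \<le> (\<integral>\<^sup>+ y. ennreal (norm (indicator \<Omega> y *\<^sub>R k x y)) \<partial>lebesgue)"
      using integral_norm_bound_ennreal[OF int] by (simp add: set_lebesgue_integral_def)
    then have "\<bar>LINT y:\<Omega>|lebesgue. k x y\<bar> \<le> N * r"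
      using le real N0 by (meson ennreal_le_iff mult_nonneg_nonneg order_trans)
    then have "\<bar>LINT y:\<Omega>|lebesgue. k x y\<bar> / N \<le> r"
      using N0 real by (cases "N = 0") (auto simp: divide_le_eq mult.commute)
    then have "lam / w * (\<bar>LINT y:\<Omega>|lebesgue. k x y\<bar> / N) powr q \<le> lam / w * r powr q"
      using N0 pq lam w_pos by (intro mult_left_mono powr_mono2) auto
    then show ?thesis using int real
      by (simp add: set_integrable_def \<Phi>_def c_def ennreal_leI)
  qed
  have [measurable]: "(\<lambda>x. \<Phi> (U x)) \<in> borel_measurable borel"
    unfolding \<Phi>_def[abs_def] by measurable
  have "exp_functional \<nu> \<Omega> (lam / w) q k N \<le> (\<integral>\<^sup>+ x. indicator \<Omega> x * \<Phi> (U x) \<partial>\<nu>)"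
    unfolding exp_functional_def
  proof (rule nn_integral_mono)
    fix x
    show "(if set_integrable lebesgue \<Omega> (k x)
        then ennreal (exp (lam / w * (\<bar>LINT y:\<Omega>|lebesgue. k x y\<bar> / N) powr q)) else \<infinity>) * indicator \<Omega> x
      \<le> indicator \<Omega> x * \<Phi> (U x)"
      using pw[of x] by (cases "x \<in> \<Omega>") (simp_all only: indicator_simps mult_1_right mult_1_left mult_zero_right mult_zero_left order_refl not_False_eq_True)
  qed
  also have "\<dots> = (\<integral>\<^sup>+ x. \<Phi> (U x) \<partial>M)"
    unfolding M using \<Omega> \<nu> by (subst nn_integral_density) (auto simp: measurable_cong_sets[OF \<nu> refl])
  also have "\<dots> \<le> ennreal (exp 1 * S)" by (rule exp_integral_le)
  finally show ?thesis unfolding N_def .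
qed

section \<open>Lower bounds from test functions on annuli\<close>

text \<open>With \<open>l = w * ln (r / \<epsilon>)\<close>, the p-th power of the norm of
  \<open>g\<close> is \<open>l\<close>, while the potential is at least \<open>\<theta> * l\<close>
  near \<open>x0\<close>. The quotient \<open>\<theta> * l powr (1 - d / n)\<close> has q-th power
  \<open>\<theta> powr q * l\<close>, for \<open>q = n / (n - d)\<close>.\<close>

lemma exp_functional_ge:
  fixes g :: "'a::euclidean_space \<Rightarrow> 'b::euclidean_space" and k :: "'a \<Rightarrow> 'a \<Rightarrow> real"
    and \<Omega> :: "'a set" and \<nu> :: "'a measure"
  defines "n \<equiv> real DIM('a)" and "w \<equiv> sphere_area DIM('a)"
  assumes \<Omega>: "open \<Omega>" "cball x0 r \<subseteq> \<Omega>" and \<nu>: "sets \<nu> = sets borel"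
    and low: "ennreal m \<le> emeasure \<nu> (ball x0 s \<inter> \<Omega>)"
    and \<epsilon>: "0 < \<epsilon>" "\<epsilon> < r" and \<beta>: "0 \<le> \<beta>" and \<theta>: "0 \<le> \<theta>" and d: "0 < d" "d < n"
    and g: "\<And>y. norm (g y) = norm (x0 - y) powr (- d) * indicator {\<epsilon>..r} (norm (x0 - y))"
    and k: "\<And>x y. x \<in> ball x0 s \<Longrightarrow> k x y \<ge> \<theta> * (norm (x0 - y) powr (- n) * indicator {\<epsilon>..r} (norm (x0 - y)))"
  shows "ennreal (exp (\<beta> * w * \<theta> powr (n / (n - d)) * ln (r / \<epsilon>)) * m)
    \<le> exp_functional \<nu> \<Omega> \<beta> (n / (n - d)) k (Lp_norm_on \<Omega> (n / d) g)"
    and "g \<in> borel_measurable borel \<Longrightarrow> g \<in> Lp_on \<Omega> (n / d)"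
proof -
  define \<phi> where "\<phi> y = norm (x0 - y) powr (- n) * indicator {\<epsilon>..r} (norm (x0 - y))" for y
  define l where "l = w * ln (r / \<epsilon>)"
  have "w > 0" unfolding w_def by (intro sphere_area_pos) auto
  then have l: "l > 0" using \<epsilon> by (simp add: l_def)
  have \<phi>m [measurable]: "\<phi> \<in> borel_measurable borel" unfolding \<phi>_def[abs_def] by measurable
  have \<phi>0: "\<phi> y \<ge> 0" for y by (simp add: \<phi>_def)
  have \<phi>\<Omega>: "\<phi> y = 0" if "y \<notin> \<Omega>" for y
    using that \<Omega>(2) by (auto simp: \<phi>_def indicator_def dist_norm)
  have "(\<integral>\<^sup>+ y. ennreal (\<phi> y) \<partial>lborel) = (\<integral>\<^sup>+ z. ennreal (norm (z::'a) powr (- n) * indicator {\<epsilon>..r} (norm z)) \<partial>lborel)"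
    unfolding \<phi>_def by (rule nn_integral_lborel_reflect[of "\<lambda>z. ennreal (norm z powr (- n) * indicator {\<epsilon>..r} (norm z))"]) measurable
  also have "\<dots> = ennreal l"
    unfolding n_def l_def w_def using \<epsilon> by (intro nn_integral_radial_annulus) auto
  finally have nn: "(\<integral>\<^sup>+ y. ennreal (\<phi> y) \<partial>lebesgue) = ennreal l"
    by (simp add: nn_integral_completion)
  have "norm (g y) powr (n / d) = \<phi> y" for y
    using d by (auto simp: g \<phi>_def indicator_def powr_powr)
  then have I: "(\<integral>\<^sup>+ y\<in>\<Omega>. ennreal (norm (g y) powr (n / d)) \<partial>lebesgue) = ennreal l"
    unfolding nn[symmetric] using \<phi>\<Omega> by (intro nn_integral_cong) (auto simp: indicator_def)
  show "g \<in> Lp_on \<Omega> (n / d)" if [measurable]: "g \<in> borel_measurable borel"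
  proof -
    have [measurable]: "\<Omega> \<in> sets borel" using \<Omega> by simp
    have "(\<lambda>y. indicator \<Omega> y *\<^sub>R g y) \<in> borel_measurable borel" by measurable
    then show ?thesis using I by (simp add: Lp_on_def set_borel_measurable_def measurable_completion)
  qed
  define N where "N = Lp_norm_on \<Omega> (n / d) g"
  have N: "N = l powr (d / n)" unfolding N_def Lp_norm_on_def I using l by simp
  have \<phi>int: "has_bochner_integral lebesgue \<phi> l"
    using nn \<phi>0 l by (intro has_bochner_integral_nn_integral) (auto intro: measurable_completion)
  define K where "K = exp (\<beta> * w * \<theta> powr (n / (n - d)) * ln (r / \<epsilon>))"
  have pw: "ennreal K \<le> (if set_integrable lebesgue \<Omega> (k x)
      then ennreal (exp (\<beta> * (\<bar>LINT y:\<Omega>|lebesgue. k x y\<bar> / N) powr (n / (n - d)))) else \<infinity>)"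
    if x: "x \<in> ball x0 s" for x
  proof (cases "set_integrable lebesgue \<Omega> (k x)")
    case True
    have "\<theta> * l = (\<integral> y. \<theta> * \<phi> y \<partial>lebesgue)"
      using has_bochner_integral_integral_eq[OF \<phi>int] by simp
    also have "\<dots> \<le> (LINT y:\<Omega>|lebesgue. k x y)"
      unfolding set_lebesgue_integral_def
    proof (rule integral_mono)
      show "integrable lebesgue (\<lambda>y. \<theta> * \<phi> y)"
        using \<phi>int by (intro integrable_mult_right) (auto simp: has_bochner_integral_iff)
      show "integrable lebesgue (\<lambda>y. indicator \<Omega> y *\<^sub>R k x y)"
        using True by (simp add: set_integrable_def)
      show "\<theta> * \<phi> y \<le> indicator \<Omega> y *\<^sub>R k x y" for y
        using k[OF x, of y, folded \<phi>_def] \<phi>\<Omega>[of y] by (cases "y \<in> \<Omega>") auto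
    qed
    finally have "\<theta> * l \<le> \<bar>LINT y:\<Omega>|lebesgue. k x y\<bar>" by simp
    then have "\<theta> * l / N \<le> \<bar>LINT y:\<Omega>|lebesgue. k x y\<bar> / N"
      using l by (intro divide_right_mono) (auto simp: N)
    then have "(\<theta> * l / N) powr (n / (n - d)) \<le> (\<bar>LINT y:\<Omega>|lebesgue. k x y\<bar> / N) powr (n / (n - d))"
      using d \<theta> l by (intro powr_mono2) (auto simp: N)
    moreover have "(\<theta> * l / N) powr (n / (n - d)) = \<theta> powr (n / (n - d)) * l"
    proof -
      have Nl: "\<theta> * l / N = \<theta> * l powr (1 - d / n)" using l by (simp add: N powr_diff)
      have ex: "(1 - d / n) * (n / (n - d)) = 1" using d by (simp add: field_simps)
      have "(l powr (1 - d / n)) powr (n / (n - d)) = l" unfolding powr_powr ex using l by simp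
      then show ?thesis unfolding Nl using \<theta> by (simp only: powr_mult powr_ge_zero)
    qed
    ultimately have "\<beta> * (\<theta> powr (n / (n - d)) * l) \<le> \<beta> * (\<bar>LINT y:\<Omega>|lebesgue. k x y\<bar> / N) powr (n / (n - d))"
      using \<beta> by (intro mult_left_mono) auto
    then have "K \<le> exp (\<beta> * (\<bar>LINT y:\<Omega>|lebesgue. k x y\<bar> / N) powr (n / (n - d)))"
      unfolding K_def l_def by (simp add: mult_ac)
    then show ?thesis using True by (simp add: ennreal_leI)
  qed simp
  have "ennreal (K * m) \<le> ennreal K * emeasure \<nu> (ball x0 s \<inter> \<Omega>)"
    using low by (simp add: K_def ennreal_mult' mult_left_mono)
  also have "\<dots> = (\<integral>\<^sup>+ x. ennreal K * indicator (ball x0 s \<inter> \<Omega>) x \<partial>\<nu>)"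
    using \<Omega> by (intro nn_integral_cmult_indicator[symmetric]) (simp add: \<nu>)
  also have "\<dots> \<le> exp_functional \<nu> \<Omega> \<beta> (n / (n - d)) k N"
    unfolding exp_functional_def
  proof (rule nn_integral_mono)
    fix x
    show "ennreal K * indicator (ball x0 s \<inter> \<Omega>) x \<le> (if set_integrable lebesgue \<Omega> (k x)
      then ennreal (exp (\<beta> * (\<bar>LINT y:\<Omega>|lebesgue. k x y\<bar> / N) powr (n / (n - d)))) else \<infinity>) * indicator \<Omega> x"
    proof (cases "x \<in> ball x0 s \<inter> \<Omega>")
      case True
      then have "x \<in> ball x0 s" "x \<in> \<Omega>" by simp_all
      then show ?thesis using pw[of x] True by (simp only: indicator_simps mult_1_right)
    next
      case False
      then show ?thesis by (simp only: indicator_simps mult_zero_right not_False_eq_True zero_le)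
    qed
  qed
  finally show "ennreal (exp (\<beta> * w * \<theta> powr (n / (n - d)) * ln (r / \<epsilon>)) * m)
    \<le> exp_functional \<nu> \<Omega> \<beta> (n / (n - d)) k (Lp_norm_on \<Omega> (n / d) g)"
    unfolding N_def K_def .
qed

subsection \<open>The potentials of the theorem\<close>

lemma T_kernel_le:
  "\<bar>T_kernel d f x y\<bar> \<le> norm (x - y) powr (- (real DIM('a) - d)) * norm (f (y :: 'a::euclidean_space))"
  by (simp add: T_kernel_def abs_mult)

lemma T1_kernel_le:
  fixes F :: "'a::euclidean_space \<Rightarrow> 'a"
  shows "\<bar>T1_kernel d F x y\<bar> \<le> norm (x - y) powr (- (real DIM('a) - d)) * norm (F y)"
proof (cases "x = y")
  case False
  have "\<bar>T1_kernel d F x y\<bar> \<le> norm (x - y) powr (d - real DIM('a) - 1) * (norm (x - y) * norm (F y))"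
    unfolding T1_kernel_def abs_mult by (intro mult_mono Cauchy_Schwarz_ineq2) auto
  also have "\<dots> = norm (x - y) powr (d - real DIM('a) - 1) * norm (x - y) powr 1 * norm (F y)"
    by simp
  also have "norm (x - y) powr (d - real DIM('a) - 1) * norm (x - y) powr 1 = norm (x - y) powr (- (real DIM('a) - d))"
    unfolding powr_add[symmetric] by simp
  finally show ?thesis .
qed (simp add: T1_kernel_def)

lemma T_kernel_measurable:
  fixes f :: "'a::euclidean_space \<Rightarrow> real"
  assumes "f \<in> Lp_on \<Omega> p"
  shows "set_borel_measurable lebesgue \<Omega> (T_kernel d f x)"
proof -
  have [measurable]: "(\<lambda>y. indicator \<Omega> y *\<^sub>R f y) \<in> borel_measurable lebesgue"
    using assms by (simp add: Lp_on_def set_borel_measurable_def)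
  have [measurable]: "(\<lambda>y. norm (x - y) powr (d - real DIM('a))) \<in> borel_measurable lebesgue"
    by (rule measurable_completion) measurable
  have "(\<lambda>y. norm (x - y) powr (d - real DIM('a)) * (indicator \<Omega> y *\<^sub>R f y)) \<in> borel_measurable lebesgue"
    by measurable
  then show ?thesis by (simp add: set_borel_measurable_def T_kernel_def mult.left_commute)
qed

lemma T1_kernel_measurable:
  fixes F :: "'a::euclidean_space \<Rightarrow> 'a"
  assumes "F \<in> Lp_on \<Omega> p"
  shows "set_borel_measurable lebesgue \<Omega> (T1_kernel d F x)"
proof -
  have [measurable]: "(\<lambda>y. indicator \<Omega> y *\<^sub>R F y) \<in> borel_measurable lebesgue"
    using assms by (simp add: Lp_on_def set_borel_measurable_def)
  have [measurable]: "(\<lambda>y. norm (x - y) powr (d - real DIM('a) - 1)) \<in> borel_measurable lebesgue"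
    "(\<lambda>y. x - y) \<in> borel_measurable lebesgue"
    by (rule measurable_completion, measurable)+
  have "(\<lambda>y. norm (x - y) powr (d - real DIM('a) - 1) * ((x - y) \<bullet> (indicator \<Omega> y *\<^sub>R F y))) \<in> borel_measurable lebesgue"
    by measurable
  then show ?thesis by (simp add: set_borel_measurable_def T1_kernel_def mult.left_commute)
qed

text \<open>Finitely many balls of radius \<open>r0\<close> cover the compact closure.\<close>

lemma emeasure_bounded_set_finite:
  fixes \<Omega> :: "'a::euclidean_space set"
  assumes "bounded \<Omega>" and \<nu>: "sets \<nu> = sets borel" and \<Omega>: "\<Omega> \<in> sets borel" and r0: "0 < r0"
    and fin: "\<And>x. emeasure \<nu> (ball x r0 \<inter> \<Omega>) < \<infinity>"
  shows "emeasure \<nu> \<Omega> < \<infinity>"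
proof -
  have "compact (closure \<Omega>)" using \<open>bounded \<Omega>\<close> by simp
  moreover have "closure \<Omega> \<subseteq> (\<Union>x\<in>closure \<Omega>. ball x r0)" using r0 by force
  ultimately obtain C where C: "finite C" "closure \<Omega> \<subseteq> (\<Union>x\<in>C. ball x r0)"
    using compactE_image[of "closure \<Omega>" "closure \<Omega>" "\<lambda>x. ball x r0"] by (metis open_ball)
  have "(\<Union>x\<in>C. ball x r0 \<inter> \<Omega>) \<in> sets \<nu>"
    using C \<Omega> by (intro sets.finite_UN sets.Int) (auto simp: \<nu>)
  moreover have "\<Omega> \<subseteq> (\<Union>x\<in>C. ball x r0 \<inter> \<Omega>)" using C closure_subset[of \<Omega>] by blast
  ultimately have "emeasure \<nu> \<Omega> \<le> emeasure \<nu> (\<Union>x\<in>C. ball x r0 \<inter> \<Omega>)"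
    by (intro emeasure_mono)
  also have "\<dots> \<le> (\<Sum>x\<in>C. emeasure \<nu> (ball x r0 \<inter> \<Omega>))"
    using C \<Omega> by (intro emeasure_subadditive_finite) (auto simp: \<nu>)
  also have "\<dots> < \<infinity>" using C fin by simp
  finally show ?thesis .
qed

lemma frostman_density:
  fixes \<Omega> :: "'a::euclidean_space set"
  assumes "bounded \<Omega>" "\<Omega> \<in> sets borel" and \<nu>: "sets \<nu> = sets borel"
    and lam: "0 < lam" and r0: "0 < r0" and C': "0 < C'"
    and ball: "\<And>x r. 0 < r \<Longrightarrow> r \<le> r0 \<Longrightarrow> emeasure \<nu> (ball x r \<inter> \<Omega>) \<le> ennreal (C' * r powr lam)"
    and d: "0 < d" "d < real DIM('a)"
  obtains A R where
    "frostman_measure (density \<nu> (indicator \<Omega>)) (real DIM('a)) d (real DIM('a) - d) (real DIM('a) / d)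
      (real DIM('a) / (real DIM('a) - d)) (sphere_area DIM('a)) lam A R"
    "\<And>x y. x \<in> \<Omega> \<Longrightarrow> y \<in> \<Omega> \<Longrightarrow> norm (x - y) < R"
proof -
  have "emeasure \<nu> (ball x r0 \<inter> \<Omega>) < \<infinity>" for x
    using ball[of r0 x] r0 by (auto intro: le_less_trans)
  then have "emeasure \<nu> \<Omega> < \<infinity>"
    using emeasure_bounded_set_finite[OF assms(1) \<nu> assms(2) r0] by blast
  then obtain V where V: "emeasure \<nu> \<Omega> = ennreal V" "V \<ge> 0" by (cases "emeasure \<nu> \<Omega>") auto
  obtain B where B: "\<And>x. x \<in> \<Omega> \<Longrightarrow> norm x \<le> B" "B > 0"
    using \<open>bounded \<Omega>\<close> by (auto simp: bounded_pos)
  \<comment> \<open>The second summand handles radii beyond \<open>r0\<close>, where only the total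
    mass \<open>V\<close> is available.\<close>
  define A where "A = C' + V / r0 powr lam"
  define R where "R = 2 * B + 1 + V powr (1 / lam)"
  have R: "R > 0" "V powr (1 / lam) \<le> R" using B by (auto simp: R_def add_pos_nonneg)
  have A: "A > 0" using C' V by (simp add: A_def add_pos_nonneg)
  have em: "emeasure (density \<nu> (indicator \<Omega>)) X = emeasure \<nu> (X \<inter> \<Omega>)" if "X \<in> sets borel" for X
    using that assms(2) by (subst emeasure_density)
      (auto simp: \<nu> measurable_cong_sets[OF \<nu> refl] nn_integral_indicator[symmetric] indicator_inter_arith mult.commute
        simp del: nn_integral_indicator)
  show ?thesis
  proof
    show "norm (x - y) < R" if "x \<in> \<Omega>" "y \<in> \<Omega>" for x y
      using norm_triangle_ineq4[of x y] B(1)[OF that(1)] B(1)[OF that(2)] powr_ge_zero[of V "1 / lam"]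
      unfolding R_def by linarith
    show "frostman_measure (density \<nu> (indicator \<Omega>)) (real DIM('a)) d (real DIM('a) - d) (real DIM('a) / d)
      (real DIM('a) / (real DIM('a) - d)) (sphere_area DIM('a)) lam A R"
    proof
      show "emeasure (density \<nu> (indicator \<Omega>)) UNIV \<le> ennreal (R powr lam)"
      proof -
        have "V = (V powr (1 / lam)) powr lam" using V lam by (simp add: powr_powr)
        also have "\<dots> \<le> R powr lam" using R lam by (intro powr_mono2) auto
        finally show ?thesis by (simp add: em V ennreal_leI)
      qed
      show "emeasure (density \<nu> (indicator \<Omega>)) (ball x r) \<le> ennreal (A * r powr lam)" if r: "0 < r" for x r
      proof (cases "r \<le> r0")
        case True
        have "emeasure \<nu> (ball x r \<inter> \<Omega>) \<le> ennreal (C' * r powr lam)" using ball r True by auto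
        also have "\<dots> \<le> ennreal (A * r powr lam)"
          using V by (intro ennreal_leI mult_right_mono) (auto simp: A_def)
        finally show ?thesis by (simp add: em)
      next
        case False
        have "emeasure \<nu> (ball x r \<inter> \<Omega>) \<le> ennreal V"
          unfolding V(1)[symmetric] using assms(2) by (intro emeasure_mono) (auto simp: \<nu>)
        also have "V = V / r0 powr lam * r0 powr lam" using r0 by simp
        also have "\<dots> \<le> A * r powr lam"
          using False r0 lam V C' by (intro mult_mono powr_mono2) (auto simp: A_def)
        finally show ?thesis by (simp add: em ennreal_leI)
      qed
    qed (use d lam A R in \<open>auto simp: \<nu>\<close>)
  qed
qed

section \<open>Sharpness of the constant\<close>

text \<open>The factor lost by moving from \<open>x0\<close> to nearby points tends to 1 with
  \<open>\<eta>\<close>, so a strict inequality survives for small \<open>\<eta>\<close>.\<close>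

lemma exists_dilation:
  fixes b e lam q :: real
  assumes "lam < b" "q > 0"
  obtains \<eta> where "0 < \<eta>" "\<eta> < 1" "lam < b * ((1 - \<eta>) * (1 + \<eta>) powr (- e)) powr q"
proof -
  have "((\<lambda>\<eta>. b * ((1 - \<eta>) * (1 + \<eta>) powr (- e)) powr q) \<longlongrightarrow> b * ((1 - 0) * (1 + 0) powr (- e)) powr q) (at_right 0)"
    by (intro tendsto_intros) auto
  then have "eventually (\<lambda>\<eta>. lam < b * ((1 - \<eta>) * (1 + \<eta>) powr (- e)) powr q) (at_right 0)"
    using assms by (intro order_tendstoD(1)) auto
  moreover have "eventually (\<lambda>\<eta>::real. \<eta> \<in> {0<..<1}) (at_right 0)"
    by (rule eventually_at_right_real) simp
  ultimately have "eventually (\<lambda>\<eta>. \<eta> \<in> {0<..<1} \<and> lam < b * ((1 - \<eta>) * (1 + \<eta>) powr (- e)) powr q) (at_right 0)"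
    by eventually_elim simp
  then obtain \<eta> where "\<eta> \<in> {0<..<1} \<and> lam < b * ((1 - \<eta>) * (1 + \<eta>) powr (- e)) powr q"
    using eventually_happens'[OF trivial_limit_at_right_real] by blast
  then show ?thesis using that by auto
qed

lemma exists_small_scale:
  fixes K \<kappa> B r r1 :: real
  assumes "K > 0" "\<kappa> > 0" "r > 0" "r1 > 0"
  obtains \<epsilon> where "0 < \<epsilon>" "\<epsilon> < r" "\<epsilon> \<le> r1" "K * \<epsilon> powr (- \<kappa>) > B"
proof -
  define X where "X = \<bar>B\<bar> / K + 1"
  have X: "X > 0" using assms by (simp add: X_def add_nonneg_pos)
  define \<epsilon> where "\<epsilon> = min (r / 2) (min r1 (X powr (- 1 / \<kappa>)))"
  have \<epsilon>: "0 < \<epsilon>" "\<epsilon> < r" "\<epsilon> \<le> r1" "\<epsilon> \<le> X powr (- 1 / \<kappa>)" using assms X by (auto simp: \<epsilon>_def min_less_iff_disj)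
  have "X = (X powr (- 1 / \<kappa>)) powr (- \<kappa>)" using X assms by (simp add: powr_powr)
  also have "\<dots> \<le> \<epsilon> powr (- \<kappa>)" using \<epsilon> assms by (intro powr_mono2') auto
  finally have "K * X \<le> K * \<epsilon> powr (- \<kappa>)" using assms by simp
  moreover have "K * X = \<bar>B\<bar> + K" using assms by (simp add: X_def field_simps)
  ultimately have "B < K * \<epsilon> powr (- \<kappa>)" using assms by linarith
  with \<epsilon> that show ?thesis by blast
qed

text \<open>Seen from a far point \<open>y\<close>, the points \<open>x\<close> and
  \<open>x0\<close> differ by a relative error \<open>\<eta>\<close>. The inner product estimate is
  what the vector potential requires.\<close>

lemma annulus_comparison:
  fixes x x0 y :: "'a::euclidean_space"
  assumes \<eta>: "0 < \<eta>" "\<eta> < 1" and x: "norm (x0 - x) < \<eta> * norm (x0 - y)"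
  shows "0 < norm (x - y)" "norm (x - y) \<le> (1 + \<eta>) * norm (x0 - y)"
    "(1 - \<eta>) * (norm (x0 - y))\<^sup>2 \<le> (x - y) \<bullet> (x0 - y)"
proof -
  have pos: "0 < norm (x0 - y)" using x \<eta> norm_ge_zero[of "x0 - x"]
    by (metis less_le_trans less_irrefl mult_eq_0_iff norm_ge_zero order_le_less not_le)
  have "\<eta> * norm (x0 - y) < 1 * norm (x0 - y)" using \<eta> pos by (intro mult_strict_right_mono)
  then have "norm (x0 - x) < norm (x0 - y)" using x by simp
  then show "0 < norm (x - y)" by auto
  have "norm (x - y) \<le> norm (x - x0) + norm (x0 - y)" using norm_triangle_ineq[of "x - x0" "x0 - y"] by simp
  then show "norm (x - y) \<le> (1 + \<eta>) * norm (x0 - y)" using x by (simp add: norm_minus_commute algebra_simps)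
  have "(x - y) \<bullet> (x0 - y) = (norm (x0 - y))\<^sup>2 - (x0 - x) \<bullet> (x0 - y)"
    by (simp add: power2_norm_eq_inner inner_diff_left inner_diff_right)
  moreover have "(x0 - x) \<bullet> (x0 - y) \<le> norm (x0 - x) * norm (x0 - y)"
    by (rule norm_cauchy_schwarz)
  moreover have "norm (x0 - x) * norm (x0 - y) \<le> \<eta> * norm (x0 - y) * norm (x0 - y)"
    using x by (intro mult_right_mono) auto
  ultimately show "(1 - \<eta>) * (norm (x0 - y))\<^sup>2 \<le> (x - y) \<bullet> (x0 - y)"
    by (simp add: power2_eq_square algebra_simps)
qed

text \<open>The functional is at least of order
  \<open>(r / \<epsilon>) powr (lam + \<kappa>)\<close> times the mass
  \<open>C1 * (\<eta> * \<epsilon>) powr lam\<close> of a small ball, hence of order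
  \<open>\<epsilon> powr (- \<kappa>)\<close>. The premise \<open>family\<close> isolates what
  differs between the two potentials.\<close>

lemma exp_functional_unbounded:
  fixes \<Omega> :: "'a::euclidean_space set" and \<nu> :: "'a measure"
    and k :: "('a \<Rightarrow> 'b::euclidean_space) \<Rightarrow> 'a \<Rightarrow> 'a \<Rightarrow> real"
  defines "n \<equiv> real DIM('a)"
  assumes \<Omega>: "open \<Omega>" "x0 \<in> \<Omega>" and \<nu>: "sets \<nu> = sets borel" and lam: "0 < lam" and d: "0 < d" "d < n"
    and r1: "0 < r1" and C1: "0 < C1"
    and low: "\<And>r. 0 < r \<Longrightarrow> r \<le> r1 \<Longrightarrow> ennreal (C1 * r powr lam) \<le> emeasure \<nu> (ball x0 r \<inter> \<Omega>)"
    and \<beta>: "\<beta> > lam / sphere_area DIM('a)"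
    and family: "\<And>\<eta> \<epsilon> r. 0 < \<eta> \<Longrightarrow> \<eta> < 1 \<Longrightarrow> 0 < \<epsilon> \<Longrightarrow> \<epsilon> < r \<Longrightarrow> \<exists>g\<in>borel_measurable borel.
        (\<forall>y. norm (g y) = norm (x0 - y) powr (- d) * indicator {\<epsilon>..r} (norm (x0 - y))) \<and>
        (\<forall>x\<in>ball x0 (\<eta> * \<epsilon>). \<forall>y. k g x y \<ge>
           (1 - \<eta>) * (1 + \<eta>) powr (- (n - d + 1)) * (norm (x0 - y) powr (- n) * indicator {\<epsilon>..r} (norm (x0 - y))))"
  shows "\<not> (\<exists>C::real. \<forall>f \<in> Lp_on \<Omega> (n / d).
    exp_functional \<nu> \<Omega> \<beta> (n / (n - d)) (k f) (Lp_norm_on \<Omega> (n / d) f) \<le> ennreal C)"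
proof
  let ?w = "sphere_area DIM('a)" and ?q = "n / (n - d)"
  assume "\<exists>C::real. \<forall>f \<in> Lp_on \<Omega> (n / d).
    exp_functional \<nu> \<Omega> \<beta> (n / (n - d)) (k f) (Lp_norm_on \<Omega> (n / d) f) \<le> ennreal C"
  then obtain C where C: "\<And>f. f \<in> Lp_on \<Omega> (n / d) \<Longrightarrow>
      exp_functional \<nu> \<Omega> \<beta> ?q (k f) (Lp_norm_on \<Omega> (n / d) f) \<le> ennreal C" by blast
  have w: "?w > 0" by (intro sphere_area_pos) auto
  have \<beta>0: "\<beta> \<ge> 0" using \<beta> w lam by (smt (verit) divide_nonneg_nonneg)
  obtain r where r: "r > 0" "cball x0 r \<subseteq> \<Omega>"
    using \<Omega> open_contains_cball by blast
  have "lam < \<beta> * ?w" using \<beta> w by (simp add: divide_less_eq)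
  then obtain \<eta> where \<eta>: "0 < \<eta>" "\<eta> < 1" "lam < \<beta> * ?w * ((1 - \<eta>) * (1 + \<eta>) powr (- (n - d + 1))) powr ?q"
    using exists_dilation[of lam "\<beta> * ?w" ?q "n - d + 1"] d by auto
  define \<theta> where "\<theta> = (1 - \<eta>) * (1 + \<eta>) powr (- (n - d + 1))"
  define \<kappa> where "\<kappa> = \<beta> * ?w * \<theta> powr ?q - lam"
  have \<theta>: "\<theta> \<ge> 0" using \<eta> by (simp add: \<theta>_def)
  have \<kappa>: "\<kappa> > 0" using \<eta>(3) by (simp add: \<kappa>_def \<theta>_def)
  define K where "K = C1 * \<eta> powr lam * r powr (lam + \<kappa>)"
  have K: "K > 0" using C1 \<eta> r by (simp add: K_def)
  obtain \<epsilon> where \<epsilon>: "0 < \<epsilon>" "\<epsilon> < r" "\<epsilon> \<le> r1" "K * \<epsilon> powr (- \<kappa>) > \<bar>C\<bar>"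
    using exists_small_scale[OF K \<kappa> r(1) r1] by blast
  obtain g where g: "g \<in> borel_measurable borel"
      "\<And>y. norm (g y) = norm (x0 - y) powr (- d) * indicator {\<epsilon>..r} (norm (x0 - y))"
      "\<And>x y. x \<in> ball x0 (\<eta> * \<epsilon>) \<Longrightarrow> k g x y \<ge> \<theta> * (norm (x0 - y) powr (- n) * indicator {\<epsilon>..r} (norm (x0 - y)))"
    using family[OF \<eta>(1,2) \<epsilon>(1,2)] unfolding \<theta>_def by blast
  have "\<eta> * \<epsilon> \<le> 1 * r1" using \<eta> \<epsilon> by (intro mult_mono) auto
  then have m: "ennreal (C1 * (\<eta> * \<epsilon>) powr lam) \<le> emeasure \<nu> (ball x0 (\<eta> * \<epsilon>) \<inter> \<Omega>)"
    using \<eta> \<epsilon> by (intro low) auto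
  have "ennreal (exp (\<beta> * ?w * \<theta> powr ?q * ln (r / \<epsilon>)) * (C1 * (\<eta> * \<epsilon>) powr lam))
      \<le> exp_functional \<nu> \<Omega> \<beta> ?q (k g) (Lp_norm_on \<Omega> (n / d) g)"
    using d g unfolding n_def by (intro exp_functional_ge(1)[OF \<Omega>(1) r(2) \<nu> m \<epsilon>(1,2) \<beta>0 \<theta>]) auto
  also have "\<dots> \<le> ennreal C"
    using d g unfolding n_def by (intro C[unfolded n_def] exp_functional_ge(2)[OF \<Omega>(1) r(2) \<nu> m \<epsilon>(1,2) \<beta>0 \<theta>, of d g "k g"]) auto
  also have "exp (\<beta> * ?w * \<theta> powr ?q * ln (r / \<epsilon>)) * (C1 * (\<eta> * \<epsilon>) powr lam) = K * \<epsilon> powr (- \<kappa>)"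
  proof -
    have "exp (\<beta> * ?w * \<theta> powr ?q * ln (r / \<epsilon>)) = (r / \<epsilon>) powr (lam + \<kappa>)"
      using r \<epsilon> by (simp add: \<kappa>_def powr_def)
    also have "\<dots> = r powr (lam + \<kappa>) * (\<epsilon> powr (- lam) * \<epsilon> powr (- \<kappa>))"
      using r \<epsilon> by (simp add: powr_divide powr_add powr_minus field_simps)
    finally show ?thesis
      using \<eta> \<epsilon> by (simp add: K_def powr_mult powr_minus)
  qed
  finally have "ennreal (K * \<epsilon> powr (- \<kappa>)) \<le> ennreal C" .
  moreover have "ennreal C < ennreal (K * \<epsilon> powr (- \<kappa>))"
    using \<epsilon>(4) by (intro ennreal_lessI) auto
  ultimately show False by simp
qed

lemma T_extremal:
  fixes x0 :: "'a::euclidean_space"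
  defines "n \<equiv> real DIM('a)"
  assumes \<eta>: "0 < \<eta>" "\<eta> < 1" and \<epsilon>: "0 < \<epsilon>" "\<epsilon> < r" and d: "d < n"
  shows "\<exists>g\<in>borel_measurable borel.
        (\<forall>y. norm (g y) = norm (x0 - y) powr (- d) * indicator {\<epsilon>..r} (norm (x0 - y))) \<and>
        (\<forall>x\<in>ball x0 (\<eta> * \<epsilon>). \<forall>y. T_kernel d g x y \<ge>
           (1 - \<eta>) * (1 + \<eta>) powr (- (n - d + 1)) * (norm (x0 - y) powr (- n) * indicator {\<epsilon>..r} (norm (x0 - y))))"
proof (intro bexI conjI allI ballI)
  let ?g = "\<lambda>y. norm (x0 - y) powr (- d) * indicator {\<epsilon>..r} (norm (x0 - y))"
  show "?g \<in> borel_measurable borel" by measurable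
  show "norm (?g y) = norm (x0 - y) powr (- d) * indicator {\<epsilon>..r} (norm (x0 - y))" for y
    by (simp add: abs_mult)
  show "T_kernel d ?g x y \<ge> (1 - \<eta>) * (1 + \<eta>) powr (- (n - d + 1)) * (norm (x0 - y) powr (- n) * indicator {\<epsilon>..r} (norm (x0 - y)))"
    if x: "x \<in> ball x0 (\<eta> * \<epsilon>)" for x y
  proof (cases "norm (x0 - y) \<in> {\<epsilon>..r}")
    case True
    define s where "s = norm (x0 - y)"
    have s: "\<epsilon> \<le> s" "s > 0" using True \<epsilon> by (auto simp: s_def)
    have "\<eta> * \<epsilon> \<le> \<eta> * s" using s \<eta> by simp
    then have "norm (x0 - x) < \<eta> * norm (x0 - y)" using x by (simp add: s_def dist_norm)
    note cmp = annulus_comparison[OF \<eta> this, folded s_def]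
    \<comment> \<open>The scalar kernel loses only \<open>(1 + \<eta>) powr (- (n - d))\<close>;
      this is weakened to the form shared with the vector kernel.\<close>
    have "(1 - \<eta>) * (1 + \<eta>) powr (- (n - d + 1)) \<le> 1 * (1 + \<eta>) powr (- (n - d))"
      using \<eta> d by (intro mult_mono powr_mono) auto
    then have "(1 - \<eta>) * (1 + \<eta>) powr (- (n - d + 1)) * s powr (- n) \<le> (1 + \<eta>) powr (- (n - d)) * s powr (- n)"
      by (intro mult_right_mono) auto
    also have "\<dots> = ((1 + \<eta>) * s) powr (- (n - d)) * s powr (- d)"
      using \<eta> s by (simp add: powr_mult flip: powr_add)
    also have "\<dots> \<le> norm (x - y) powr (- (n - d)) * s powr (- d)"
      using cmp d by (intro mult_right_mono powr_mono2') auto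
    finally show ?thesis using True by (simp add: T_kernel_def n_def s_def)
  qed (simp add: T_kernel_def)
qed

text \<open>The test field points along \<open>x0 - y\<close>, so near \<open>x0\<close> the inner
  product in the kernel loses at most the factor \<open>1 - \<eta>\<close>.\<close>

lemma T1_extremal:
  fixes x0 :: "'a::euclidean_space"
  defines "n \<equiv> real DIM('a)"
  assumes \<eta>: "0 < \<eta>" "\<eta> < 1" and \<epsilon>: "0 < \<epsilon>" "\<epsilon> < r" and d: "d < n"
  shows "\<exists>g\<in>borel_measurable borel.
        (\<forall>y. norm (g y) = norm (x0 - y) powr (- d) * indicator {\<epsilon>..r} (norm (x0 - y))) \<and>
        (\<forall>x\<in>ball x0 (\<eta> * \<epsilon>). \<forall>y. T1_kernel d g x y \<ge>
           (1 - \<eta>) * (1 + \<eta>) powr (- (n - d + 1)) * (norm (x0 - y) powr (- n) * indicator {\<epsilon>..r} (norm (x0 - y))))"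
proof (intro bexI conjI allI ballI)
  let ?g = "\<lambda>y. (norm (x0 - y) powr (- d - 1) * indicator {\<epsilon>..r} (norm (x0 - y))) *\<^sub>R (x0 - y)"
  show "?g \<in> borel_measurable borel" by measurable
  show "norm (?g y) = norm (x0 - y) powr (- d) * indicator {\<epsilon>..r} (norm (x0 - y))" for y
  proof (cases "x0 = y")
    case False
    then have "norm (x0 - y) powr (- d - 1) * norm (x0 - y) = norm (x0 - y) powr (- d)"
      by (simp add: powr_diff)
    then show ?thesis by (simp add: abs_mult mult_ac)
  qed simp
  show "T1_kernel d ?g x y \<ge> (1 - \<eta>) * (1 + \<eta>) powr (- (n - d + 1)) * (norm (x0 - y) powr (- n) * indicator {\<epsilon>..r} (norm (x0 - y)))"
    if x: "x \<in> ball x0 (\<eta> * \<epsilon>)" for x y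
  proof (cases "norm (x0 - y) \<in> {\<epsilon>..r}")
    case True
    define s where "s = norm (x0 - y)"
    have s: "\<epsilon> \<le> s" "s > 0" using True \<epsilon> by (auto simp: s_def)
    have "\<eta> * \<epsilon> \<le> \<eta> * s" using s \<eta> by simp
    then have "norm (x0 - x) < \<eta> * norm (x0 - y)" using x by (simp add: s_def dist_norm)
    note cmp = annulus_comparison[OF \<eta> this, folded s_def]
    have "s powr (- n) = s powr (- (n - d + 1)) * (s powr (- d - 1) * s powr 2)"
      unfolding powr_add[symmetric] by simp
    then have "(1 - \<eta>) * (1 + \<eta>) powr (- (n - d + 1)) * s powr (- n)
        = ((1 + \<eta>) * s) powr (- (n - d + 1)) * (s powr (- d - 1) * ((1 - \<eta>) * s\<^sup>2))"
      using \<eta> s by (simp add: powr_mult powr_numeral mult_ac)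
    also have "\<dots> \<le> norm (x - y) powr (- (n - d + 1)) * (s powr (- d - 1) * ((x - y) \<bullet> (x0 - y)))"
      using cmp d \<eta> s by (intro mult_mono powr_mono2' mult_left_mono mult_nonneg_nonneg) auto
    also have "- (n - d + 1) = d - n - 1" by simp
    finally show ?thesis using True by (simp add: T1_kernel_def n_def s_def mult_ac)
  qed (simp add: T1_kernel_def)
qed

theorem theorem7:
  fixes \<Omega> :: "'a::euclidean_space set" and \<nu> :: "'a measure"
    and lam r0 C' d :: real
  assumes "open \<Omega>" and "bounded \<Omega>"
    and "sets \<nu> = sets borel"
    and "0 < lam" and "lam \<le> real DIM('a)" and "0 < r0" and "0 < C'"
    and "\<forall>x r. 0 < r \<and> r \<le> r0 \<longrightarrow> emeasure \<nu> (ball x r \<inter> \<Omega>) \<le> ennreal (C' * r powr lam)"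
    and "0 < d" and "d < real DIM('a)"
  defines "p \<equiv> real DIM('a) / d"
    and "p' \<equiv> real DIM('a) / (real DIM('a) - d)"
  shows
    "(\<exists>C::real.
        (\<forall>f \<in> Lp_on \<Omega> p. exp_functional \<nu> \<Omega> (lam / sphere_area DIM('a)) p' (T_kernel d f)
                              (Lp_norm_on \<Omega> p f) \<le> ennreal C) \<and>
        (\<forall>F \<in> Lp_on \<Omega> p. exp_functional \<nu> \<Omega> (lam / sphere_area DIM('a)) p' (T1_kernel d F)
                              (Lp_norm_on \<Omega> p F) \<le> ennreal C))
     \<and>
     ((\<exists>x0\<in>\<Omega>. \<exists>r1>0. \<exists>C1>0. \<forall>r. 0 < r \<and> r \<le> r1 \<longrightarrow>
          ennreal (C1 * r powr lam) \<le> emeasure \<nu> (ball x0 r \<inter> \<Omega>)) \<longrightarrow>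
      (\<forall>\<beta>. \<beta> > lam / sphere_area DIM('a) \<longrightarrow>
         \<not> (\<exists>C::real. \<forall>f \<in> Lp_on \<Omega> p.
               exp_functional \<nu> \<Omega> \<beta> p' (T_kernel d f) (Lp_norm_on \<Omega> p f) \<le> ennreal C) \<and>
         \<not> (\<exists>C::real. \<forall>F \<in> Lp_on \<Omega> p.
               exp_functional \<nu> \<Omega> \<beta> p' (T1_kernel d F) (Lp_norm_on \<Omega> p F) \<le> ennreal C)))"
proof (intro conjI impI allI)
  have \<Omega>: "\<Omega> \<in> sets borel" using \<open>open \<Omega>\<close> by simp
  obtain A R where
    fm: "frostman_measure (density \<nu> (indicator \<Omega>)) (real DIM('a)) d (real DIM('a) - d) p p' (sphere_area DIM('a)) lam A R"
    and diam: "\<And>x y. x \<in> \<Omega> \<Longrightarrow> y \<in> \<Omega> \<Longrightarrow> norm (x - y) < R"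
    unfolding p_def p'_def
    by (rule frostman_density[OF \<open>bounded \<Omega>\<close> \<Omega> \<open>sets \<nu> = sets borel\<close> \<open>0 < lam\<close> \<open>0 < r0\<close> \<open>0 < C'\<close> _ \<open>0 < d\<close> \<open>d < real DIM('a)\<close>])
       (use assms(8) in auto)
  interpret frostman_measure "density \<nu> (indicator \<Omega>)" "real DIM('a)" d "real DIM('a) - d" p p' "sphere_area DIM('a)" lam A R
    by (rule fm)
  show "\<exists>C::real.
        (\<forall>f \<in> Lp_on \<Omega> p. exp_functional \<nu> \<Omega> (lam / sphere_area DIM('a)) p' (T_kernel d f)
                              (Lp_norm_on \<Omega> p f) \<le> ennreal C) \<and>
        (\<forall>F \<in> Lp_on \<Omega> p. exp_functional \<nu> \<Omega> (lam / sphere_area DIM('a)) p' (T1_kernel d F)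
                              (Lp_norm_on \<Omega> p F) \<le> ennreal C)"
  \<comment> \<open>\<open>S\<close> depends only on the parameters of the measure locale, so the
    same constant serves every \<open>f\<close> and every \<open>F\<close>.\<close>
  proof (intro exI[of _ "exp 1 * S"] conjI ballI)
    show "exp_functional \<nu> \<Omega> (lam / sphere_area DIM('a)) p' (T_kernel d f) (Lp_norm_on \<Omega> p f) \<le> ennreal (exp 1 * S)"
      if "f \<in> Lp_on \<Omega> p" for f
      using that diam \<open>sets \<nu> = sets borel\<close> \<Omega>
      by (intro exp_functional_le[OF refl _ _ _ that T_kernel_measurable T_kernel_le])
    show "exp_functional \<nu> \<Omega> (lam / sphere_area DIM('a)) p' (T1_kernel d F) (Lp_norm_on \<Omega> p F) \<le> ennreal (exp 1 * S)"
      if "F \<in> Lp_on \<Omega> p" for F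
      using that diam \<open>sets \<nu> = sets borel\<close> \<Omega>
      by (intro exp_functional_le[OF refl _ _ _ that T1_kernel_measurable T1_kernel_le])
  qed
next
  fix \<beta>
  assume "\<exists>x0\<in>\<Omega>. \<exists>r1>0. \<exists>C1>0. \<forall>r. 0 < r \<and> r \<le> r1 \<longrightarrow>
          ennreal (C1 * r powr lam) \<le> emeasure \<nu> (ball x0 r \<inter> \<Omega>)"
  then obtain x0 r1 C1 where x0: "x0 \<in> \<Omega>" and r1: "0 < r1" and C1: "0 < C1"
    and low: "\<And>r. 0 < r \<Longrightarrow> r \<le> r1 \<Longrightarrow> ennreal (C1 * r powr lam) \<le> emeasure \<nu> (ball x0 r \<inter> \<Omega>)" by blast
  assume \<beta>: "\<beta> > lam / sphere_area DIM('a)"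
  note unbounded = exp_functional_unbounded[OF \<open>open \<Omega>\<close> x0 \<open>sets \<nu> = sets borel\<close> \<open>0 < lam\<close> \<open>0 < d\<close>
    \<open>d < real DIM('a)\<close> r1 C1 low \<beta>, folded p_def p'_def]
  show "\<not> (\<exists>C::real. \<forall>f \<in> Lp_on \<Omega> p.
      exp_functional \<nu> \<Omega> \<beta> p' (T_kernel d f) (Lp_norm_on \<Omega> p f) \<le> ennreal C)"
    by (rule unbounded, assumption, assumption, rule T_extremal[OF _ _ _ _ \<open>d < real DIM('a)\<close>])
  show "\<not> (\<exists>C::real. \<forall>F \<in> Lp_on \<Omega> p.
      exp_functional \<nu> \<Omega> \<beta> p' (T1_kernel d F) (Lp_norm_on \<Omega> p F) \<le> ennreal C)"
    by (rule unbounded, assumption, assumption, rule T1_extremal[OF _ _ _ _ \<open>d < real DIM('a)\<close>])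
qed

end
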